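(* Suppose that $\mathbb{P}$ is a product stationary probability on $\Omega=\mathcal{A}^{\mathbb{N}}$, i.e. the coordinate projections from $\Omega$ to $\mathcal{A}$ are i.i.d. random variables. Let $t>0$. For each $\omega\in\Omega$ and $n\ge1$ set $N^\omega_n=[t(\mathbb{P}(A^\omega_n))^{-\ell}]$, $U^\omega_n=S^{A^\omega_n}_{N^\omega_n}$, $r^\omega_n=\pi(A^\omega_n)$ and $\rho^\omega_n=\rho_{A^\omega_n}$. Then the limits $$\lim_{n\to\infty}r^\omega_n=r^\omega\in\{1,2,\dots\}\cup\{\infty\}\quad\text{and}\quad\lim_{n\to\infty}\rho^\omega_n=\rho^\omega$$ exist for any $\omega\in\Omega$. (i) If $\omega$ is not a periodic point then $U^\omega_n$ converges in distribution as $n\to\infty$ to a Poisson random variable with parameter $t$. (ii) If $\omega$ is a periodic point (sequence) of minimal period $d$ then $r^\omega=d$ and $\rho^\omega=(\mathbb{P}(A^\omega_d))^{k_0}$, where $$k_0=\frac{\kappa^\omega}{r^\omega}\sum_{i=1}^\ell d_i,\qquad \kappa^\omega=\mathrm{lcm}\Big\{\frac{r^\omega}{\gcd\{r^\omega,d_i\}}:1\le i\le\ell\Big\}.$$ Furthermore, let $W$ be a Poisson random variable with parameter $t(1-\rho^\omega)$ and let $\zeta_1,\zeta_2,\dots$ be a sequence of i.i.d. random variables independent of $W$ having the geometric distribution with parameter $\rho^\omega$, i.e. $\mathbb{P}\{\zeta_1=k\}=(1-\rho^\omega)(\rho^\omega)^{k-1}$, $k=1,2,\dots$. Then $U^\omega_n$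 converges in distribution to $Y^\omega=\sum_{k=1}^W\zeta_k$ as $n\to\infty$.
   Context: $\mathbb{N}=\{0,1,2,\dots\}$; $[x]$ is the integral part of a number $x$. $\mathcal{A}$ is a finite or countable alphabet with more than one element, $\Omega=\mathcal{A}^{\mathbb{N}}$ with the $\sigma$-algebra generated by cylinder sets, $T$ is the left shift $(T\omega)_i=\omega_{i+1}$, and $\mathbb{P}$ is a $T$-invariant probability on $\Omega$ such that every cylinder $[a]=\{\omega:\omega_0=a\}$, $a\in\mathcal{A}$, has positive probability. $\mathcal{C}_n$ is the set of all $n$-cylinders $[a_0,\dots,a_{n-1}]=\{\omega\in\Omega:\omega_i=a_i,\ 0\le i\le n-1\}$. For $A\in\mathcal{C}_n$, $\pi(A)=\min\{k\in\{1,\dots,n\}:A\cap T^{-k}A\ne\emptyset\}$. For $\omega\in\Omega$, $A^\omega_n=[\omega_0,\dots,\omega_{n-1}]$. A point $\omega$ is periodic if $T^d\omega=\omega$ for some $d\ge1$; the least such $d$ is its minimal period. Let $\ell\ge1$ and $q_i(k)=d_ik$, $i=1,\dots,\ell$, with integers $1\le d_1<d_2<\cdots<d_\ell$. For $A\in\mathcal{C}_n$: $X^A_k=\prod_{i=1}^\ell\mathbb{I}_A\circ T^{d_ik}$ and $S^A_N=\sum_{k=1}^NX^A_k$. For $R=[a_0,\dots,a_{r-1}]\in\mathcal{C}_r$ and an integer $n\ge r$, $$R^{n/r}=\Big(\bigcap_{k=0}^{[n/r]-1}T^{-kr}R\Big)\cap T^{-r[n/r]}\big([a_0,\dots,a_{n-r[n/r]-1}]\big),$$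 where the last cylinder is $\Omega$ if $r$ divides $n$; thus $R^{n/r}$ is the $n$-cylinder obtained by repeating $a_0,\dots,a_{r-1}$ periodically. For $A=[a_0,\dots,a_{n-1}]\in\mathcal{C}_n$ with $\mathbb{P}(A)>0$ put $r=\pi(A)$, $R=[a_0,\dots,a_{r-1}]$, $$\kappa=\mathrm{lcm}\Big\{\frac{r}{\gcd\{r,d_i\}}:1\le i\le\ell\Big\},\qquad \rho_A=\prod_{i=1}^\ell\mathbb{P}\big(R^{(n+d_i\kappa)/r}\,\big|\,A\big).$$ *)

theory Defs
  imports "HOL-Probability.Probability"
begin

text \<open>The alphabet is a type \<open>'a :: countable\<close>, and \<open>\<Omega>\<close> is the type \<open>nat \<Rightarrow> 'a\<close>. An
  \<open>n\<close>-cylinder is represented by its word \<open>[a\<^sub>0, \<dots>, a\<^bsub>n-1\<^esub>]\<close>, which it determines uniquely as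
  soon as the alphabet has more than one letter; the empty word gives \<open>\<Omega>\<close>.\<close>

definition shift :: "(nat \<Rightarrow> 'a) \<Rightarrow> nat \<Rightarrow> 'a" where
  "shift \<omega> = (\<lambda>i. \<omega> (Suc i))"

definition cylinder :: "'a list \<Rightarrow> (nat \<Rightarrow> 'a) set" where
  "cylinder w = {\<omega>. \<forall>i<length w. \<omega> i = w ! i}"

definition seq_space :: "(nat \<Rightarrow> 'a) measure" where
  "seq_space = sigma UNIV (range cylinder)"

definition stationary_probability :: "(nat \<Rightarrow> 'a) measure \<Rightarrow> bool" where
  "stationary_probability M \<longleftrightarrow>
     prob_space M \<and> sets M = sets seq_space \<and> distr M M shift = M \<and>
     (\<forall>a. measure M (cylinder [a]) > 0)"

definition iid_coordinates :: "(nat \<Rightarrow> 'a) measure \<Rightarrow> bool" where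
  "iid_coordinates M \<longleftrightarrow>
     prob_space.indep_vars M (\<lambda>_. count_space UNIV) (\<lambda>i \<omega>. \<omega> i) UNIV \<and>
     (\<forall>i. distr M (count_space UNIV) (\<lambda>\<omega>. \<omega> i) = distr M (count_space UNIV) (\<lambda>\<omega>. \<omega> 0))"

definition initial_word :: "(nat \<Rightarrow> 'a) \<Rightarrow> nat \<Rightarrow> 'a list" where
  "initial_word \<omega> n = map \<omega> [0..<n]"

text \<open>For nonempty \<open>w\<close> the minimum is over a nonempty set, as \<open>k = length w\<close> always belongs to it.\<close>

definition return_index :: "'a list \<Rightarrow> nat" where
  "return_index w =
     Min {k \<in> {1..length w}. cylinder w \<inter> (shift ^^ k) -` cylinder w \<noteq> {}}"

definition periodic_point :: "(nat \<Rightarrow> 'a) \<Rightarrow> bool" where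
  "periodic_point \<omega> \<longleftrightarrow> (\<exists>p\<ge>1. (shift ^^ p) \<omega> = \<omega>)"

definition minimal_period :: "(nat \<Rightarrow> 'a) \<Rightarrow> nat" where
  "minimal_period \<omega> = (LEAST p. 1 \<le> p \<and> (shift ^^ p) \<omega> = \<omega>)"

text \<open>The integers \<open>d\<^sub>1, \<dots>, d\<^sub>l\<close> are the values at \<open>1, \<dots>, l\<close> of a function \<open>d\<close>.\<close>

definition hit :: "nat \<Rightarrow> (nat \<Rightarrow> nat) \<Rightarrow> 'a list \<Rightarrow> nat \<Rightarrow> (nat \<Rightarrow> 'a) \<Rightarrow> real" where
  "hit l d w k \<omega> = (\<Prod>i=1..l. indicator (cylinder w) ((shift ^^ (d i * k)) \<omega>))"

definition hit_sum :: "nat \<Rightarrow> (nat \<Rightarrow> nat) \<Rightarrow> 'a list \<Rightarrow> nat \<Rightarrow> (nat \<Rightarrow> 'a) \<Rightarrow> real" where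
  "hit_sum l d w N \<omega> = (\<Sum>k=1..N. hit l d w k \<omega>)"

text \<open>\<open>periodic_extension w n\<close> is the cylinder \<open>R\<^bsup>n/r\<^esup>\<close> for \<open>R = cylinder w\<close> and \<open>r = length w\<close>.\<close>

definition periodic_extension :: "'a list \<Rightarrow> nat \<Rightarrow> (nat \<Rightarrow> 'a) set" where
  "periodic_extension w n =
     (let r = length w; q = n div r in
       (\<Inter>k\<in>{..<q}. (shift ^^ (k * r)) -` cylinder w) \<inter>
       (shift ^^ (r * q)) -` cylinder (take (n - r * q) w))"

definition kappa :: "nat \<Rightarrow> (nat \<Rightarrow> nat) \<Rightarrow> nat \<Rightarrow> nat" where
  "kappa l d r = Lcm ((\<lambda>i. r div gcd r (d i)) ` {1..l})"

definition rho :: "(nat \<Rightarrow> 'a) measure \<Rightarrow> nat \<Rightarrow> (nat \<Rightarrow> nat) \<Rightarrow> 'a list \<Rightarrow> real" where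
  "rho M l d w =
     (let r = return_index w; R = take r w in
       \<Prod>i=1..l. cond_prob M
         (\<lambda>\<omega>. \<omega> \<in> periodic_extension R (length w + d i * kappa l d r)) (\<lambda>\<omega>. \<omega> \<in> cylinder w))"

definition observation_time :: "(nat \<Rightarrow> 'a) measure \<Rightarrow> nat \<Rightarrow> real \<Rightarrow> 'a list \<Rightarrow> nat" where
  "observation_time M l t w = nat \<lfloor>t * measure M (cylinder w) powi (- int l)\<rfloor>"

definition hit_count ::
  "(nat \<Rightarrow> 'a) measure \<Rightarrow> nat \<Rightarrow> (nat \<Rightarrow> nat) \<Rightarrow> real \<Rightarrow> (nat \<Rightarrow> 'a) \<Rightarrow> nat \<Rightarrow> (nat \<Rightarrow> 'a) \<Rightarrow> real" where
  "hit_count M l d t \<omega> n =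
     hit_sum l d (initial_word \<omega> n) (observation_time M l t (initial_word \<omega> n))"

text \<open>Convergence in distribution of \<open>X n\<close> (on \<open>M\<close>) to \<open>Y\<close> (on the possibly different space \<open>Q\<close>).\<close>

definition converges_in_distribution ::
  "'b measure \<Rightarrow> (nat \<Rightarrow> 'b \<Rightarrow> real) \<Rightarrow> 'c measure \<Rightarrow> ('c \<Rightarrow> real) \<Rightarrow> bool" where
  "converges_in_distribution M X Q Y \<longleftrightarrow>
     weak_conv_m (\<lambda>n. distr M borel (X n)) (distr Q borel Y)"

text \<open>\<open>W\<close> is Poisson with parameter \<open>s\<close>, the variables \<open>\<zeta> 1, \<zeta> 2, \<dots>\<close> are geometric on
  \<open>{1, 2, \<dots>}\<close> with \<open>P(\<zeta> i = k) = (1 - p) p\<^bsup>k-1\<^esup>\<close> (not the convention of \<^const>\<open>geometric_pmf\<close>),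
  and \<open>W, \<zeta> 1, \<zeta> 2, \<dots>\<close> are jointly independent. The value \<open>\<zeta> 0\<close> is unused; index \<open>0\<close> of the
  independent family is taken by \<open>W\<close>.\<close>

definition poisson_geometric_family ::
  "real \<Rightarrow> real \<Rightarrow> 'b measure \<Rightarrow> ('b \<Rightarrow> nat) \<Rightarrow> (nat \<Rightarrow> 'b \<Rightarrow> nat) \<Rightarrow> bool" where
  "poisson_geometric_family s p Q W \<zeta> \<longleftrightarrow>
     prob_space Q \<and>
     prob_space.indep_vars Q (\<lambda>_. count_space UNIV) (\<lambda>i. if i = 0 then W else \<zeta> i) UNIV \<and>
     distr Q (count_space UNIV) W = measure_pmf (poisson_pmf s) \<and>
     (\<forall>i\<ge>1. \<forall>k\<ge>1. measure Q {x \<in> space Q. \<zeta> i x = k} = (1 - p) * p ^ (k - 1))"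

end

theory Submission
  imports Defs
begin

text \<open>For \<open>|\<theta>| = 1\<close> put \<open>f k = E (\<theta> ^ S k)\<close> with \<open>S k\<close> the number of hits up to time \<open>k\<close>. Then
  \<open>f k - f (k - 1) = (\<theta> - 1) * E (X k * \<theta> ^ S (k - 1))\<close>. Earlier hits at distance of order
  \<open>n\<close> from \<open>k\<close> may form a clump with the hit at \<open>k\<close>; of the remaining times only \<open>O(n)\<close> are dependent on
  them, and these are negligible because a joint hit fixes many additional letters; all other times are
  independent. Hence \<open>f k = (1 - (1 - \<theta>) * \<gamma> * q) * f (k - 1)\<close> up to a summable error, where
  \<open>q = P(A) ^ l\<close> and \<open>\<gamma>\<close> is the limit of \<open>E (\<theta> ^ H | X k = 1)\<close> for the number \<open>H\<close> of earlier
  hits in the clump. About \<open>t / q\<close> steps give the characteristic function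
  \<open>exp (- t * (1 - \<theta>) * \<gamma>)\<close>, and Levy's continuity theorem applies. Without periodicity there are no
  clumps and \<open>\<gamma> = 1\<close>. If \<open>\<omega>\<close> has minimal period \<open>p\<close>, overlapping hits differ by multiples of
  \<open>\<kappa>\<close>, each further hit of a clump costs the factor \<open>\<rho>\<close>, and
  \<open>\<gamma> = (1 - \<rho>) / (1 - \<rho> * \<theta>)\<close>.\<close>

section \<open>Independent coordinates\<close>

text \<open>The recursion runs about \<open>t / q\<close> times, so each error in one step must be
  \<open>o(q)\<close>, not merely small. A joint hit at \<open>k\<close> and \<open>m < k\<close>
  costs \<open>q\<close> times a power of \<open>c\<close> with exponent
  \<open>min n (k - m)\<close>, and the clump radius \<open>lag n\<close> grows linearly in
  \<open>n\<close>; the \<open>O(n)\<close> dependent times beyond it thus contribute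
  \<open>q * n * c ^ lag n\<close>. These times exist because a block at \<open>d j * m\<close> may
  meet a block at \<open>d i * k\<close> although \<open>m\<close> is far from \<open>k\<close>:
  distance alone does not give independence. On the other hand the radius stays below
  \<open>n / (2 * d l)\<close>, since clumps are analysed through overlaps of blocks. Errors are not
  amplified along the recursion because \<open>Re ((1 - \<theta>) * \<gamma>) >= 0\<close>. The
  times up to \<open>2 * n\<close>, among which the blocks of a single time may overlap each other,
  carry an expected number of hits of order \<open>n * P(A)\<close>, which vanishes. At a periodic
  point \<open>\<gamma>\<close> requires only probabilities of pairs of hits: within a clump the
  hits form an unbroken run backwards from \<open>k\<close>, and a power of \<open>\<theta>\<close>
  is then linear in their indicators.\<close>

definition depends_only :: "((nat \<Rightarrow> 'a) \<Rightarrow> 'b) \<Rightarrow> nat set \<Rightarrow> bool" where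
  "depends_only F A \<longleftrightarrow> (\<forall>\<omega> \<omega>'. (\<forall>i\<in>A. \<omega> i = \<omega>' i) \<longrightarrow> F \<omega> = F \<omega>')"

lemma depends_only_mono: "depends_only F A \<Longrightarrow> A \<subseteq> B \<Longrightarrow> depends_only F B"
  unfolding depends_only_def by blast

lemma depends_only_comp2:
  "depends_only F A \<Longrightarrow> depends_only G A \<Longrightarrow> depends_only (\<lambda>\<omega>. h (F \<omega>) (G \<omega>)) A"
  unfolding depends_only_def by metis

lemma depends_only_comp: "depends_only F A \<Longrightarrow> depends_only (\<lambda>\<omega>. h (F \<omega>)) A"
  unfolding depends_only_def by metis

lemma depends_only_sum:
  "(\<And>m. m \<in> I \<Longrightarrow> depends_only (F m) A) \<Longrightarrow> depends_only (\<lambda>\<omega>. \<Sum>m\<in>I. F m \<omega>) A"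
  unfolding depends_only_def by (intro allI impI sum.cong refl) blast

lemma depends_only_restrict: "depends_only F A \<Longrightarrow> F (restrict \<omega> A) = F \<omega>"
  unfolding depends_only_def by (auto dest!: spec[of _ "restrict \<omega> A"])

text \<open>A finite product of countable discrete spaces is discrete. Hence measurability of
  anything that reads finitely many letters reduces to bookkeeping of coordinates through
  \<open>depends_only\<close>.\<close>

lemma measurable_PiM_finite_countable:
  fixes F :: "(nat \<Rightarrow> 'a::countable) \<Rightarrow> 'b::topological_space"
  assumes "finite A"
  shows "F \<in> borel_measurable (PiM A (\<lambda>_. count_space UNIV))"
proof -
  have "PiM A (\<lambda>_. count_space (UNIV :: 'a set)) = count_space (PiE A (\<lambda>_. UNIV))"
    by (rule count_space_PiM_finite) (use assms in auto)
  then show ?thesis by simp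
qed

locale iid_sequence = prob_space M for M :: "(nat \<Rightarrow> 'a::countable) measure" +
  assumes space_UNIV: "space M = UNIV"
    and coord_indep: "indep_vars (\<lambda>_. count_space UNIV) (\<lambda>i \<omega>. \<omega> i) UNIV"
    and coord_distr: "prob {\<omega>. \<omega> i = a} = prob {\<omega>. \<omega> 0 = a}"
begin

definition letter_prob :: "'a \<Rightarrow> real" where
  "letter_prob a = prob {\<omega>. \<omega> 0 = a}"

lemma letter_prob_nonneg: "0 \<le> letter_prob a"
  by (simp add: letter_prob_def)

lemma depends_only_measurable:
  fixes F :: "(nat \<Rightarrow> 'a) \<Rightarrow> 'b::topological_space"
  assumes "finite A" "depends_only F A"
  shows "F \<in> borel_measurable M"
proof -
  have "(\<lambda>\<omega>. restrict (\<lambda>i. \<omega> i) A) \<in> M \<rightarrow>\<^sub>M PiM A (\<lambda>_. count_space UNIV)"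
    using coord_indep by (intro measurable_restrict) (auto simp: indep_vars_def)
  from measurable_compose[OF this measurable_PiM_finite_countable[OF assms(1), of F]]
  show ?thesis using depends_only_restrict[OF assms(2)] by simp
qed

lemma depends_only_event:
  assumes "finite A" "depends_only (\<lambda>\<omega>. \<omega> \<in> E) A"
  shows "E \<in> events"
proof -
  have "depends_only (indicator E :: _ \<Rightarrow> real) A"
    using assms(2) by (auto simp: depends_only_def indicator_def)
  from depends_only_measurable[OF assms(1) this]
  show ?thesis by (simp add: borel_measurable_indicator_iff space_UNIV)
qed

text \<open>\<open>F\<close> and \<open>G\<close> factor through the restrictions of the sequence to
  \<open>A\<close> and to \<open>B\<close>, which are independent random vectors because the index
  sets are disjoint.\<close>

lemma depends_only_integral_mult:
  fixes F G :: "(nat \<Rightarrow> 'a) \<Rightarrow> complex"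
  assumes A: "finite A" "depends_only F A" and B: "finite B" "depends_only G B"
    and disj: "A \<inter> B = {}" and F: "\<And>\<omega>. norm (F \<omega>) \<le> 1" and G: "\<And>\<omega>. norm (G \<omega>) \<le> 1"
  shows "(\<integral>\<omega>. F \<omega> * G \<omega> \<partial>M) = (\<integral>\<omega>. F \<omega> \<partial>M) * (\<integral>\<omega>. G \<omega> \<partial>M)"
proof (rule indep_var_lebesgue_integral)
  have "indep_var (PiM A (\<lambda>_. count_space UNIV)) (\<lambda>\<omega>. restrict (\<lambda>i. \<omega> i) A)
     (PiM B (\<lambda>_. count_space UNIV)) (\<lambda>\<omega>. restrict (\<lambda>i. \<omega> i) B)"
    using coord_indep disj by (rule indep_var_restrict) auto
  from indep_var_compose[OF this measurable_PiM_finite_countable[OF A(1), of F]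
      measurable_PiM_finite_countable[OF B(1), of G]]
  show "indep_var borel F borel G"
    by (simp add: o_def depends_only_restrict[OF A(2)] depends_only_restrict[OF B(2)])
  show "integrable M F" "integrable M G"
    using F G depends_only_measurable[OF A] depends_only_measurable[OF B]
    by (auto intro!: integrable_const_bound[where B = 1])
qed

lemma prob_pattern:
  assumes "finite Y" "inj_on g Y"
  shows "prob {\<omega>. \<forall>y\<in>Y. \<omega> (g y) = u y} = (\<Prod>y\<in>Y. letter_prob (u y))"
proof (cases "Y = {}")
  case True
  then show ?thesis using prob_space space_UNIV by simp
next
  case False
  define h where "h = the_inv_into Y g"
  have h: "h (g y) = y" if "y \<in> Y" for y
    using that assms by (simp add: h_def the_inv_into_f_f)
  have "{\<omega>. \<forall>y\<in>Y. \<omega> (g y) = u y} =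
     (\<Inter>i\<in>g ` Y. (\<lambda>\<omega>. \<omega> i) -` {u (h i)} \<inter> space M)"
    using h False by (auto simp: space_UNIV)
  also have "prob \<dots> = (\<Prod>i\<in>g ` Y. prob ((\<lambda>\<omega>. \<omega> i) -` {u (h i)} \<inter> space M))"
    using coord_indep by (rule indep_varsD) (use assms False in auto)
  also have "\<dots> = (\<Prod>i\<in>g ` Y. letter_prob (u (h i)))"
  proof (rule prod.cong[OF refl])
    fix i
    have "(\<lambda>\<omega>. \<omega> i) -` {u (h i)} \<inter> space M = {\<omega>. \<omega> i = u (h i)}"
      by (auto simp: space_UNIV)
    then show "prob ((\<lambda>\<omega>. \<omega> i) -` {u (h i)} \<inter> space M) = letter_prob (u (h i))"
      by (simp add: letter_prob_def coord_distr[of i "u (h i)"])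
  qed
  also have "\<dots> = (\<Prod>y\<in>Y. letter_prob (u y))"
    using assms h by (simp add: prod.reindex)
  finally show ?thesis .
qed

text \<open>Separation makes all positions \<open>e i + j\<close> distinct. The lengths
  \<open>b i\<close> may depend on the block: a truncated block and merged periodic blocks of
  different lengths occur below.\<close>

lemma prob_blocks:
  fixes e b :: "nat \<Rightarrow> nat"
  assumes I: "finite I" and sep: "\<And>i i'. i \<in> I \<Longrightarrow> i' \<in> I \<Longrightarrow> i < i' \<Longrightarrow> e i + b i \<le> e i'"
  shows "prob {\<omega>. \<forall>i\<in>I. \<forall>j<b i. \<omega> (e i + j) = u i j} = (\<Prod>i\<in>I. \<Prod>j<b i. letter_prob (u i j))"
proof -
  let ?Y = "Sigma I (\<lambda>i. {..<b i})"
  have "inj_on (\<lambda>(i, j). e i + j) ?Y"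
  proof (rule inj_onI, clarsimp)
    fix i j i' j'
    assume a: "i \<in> I" "j < b i" "i' \<in> I" "j' < b i'" "e i + j = e i' + j'"
    then show "i = i' \<and> j = j'"
      using sep[of i i'] sep[of i' i] by (cases i i' rule: linorder_cases) auto
  qed
  then have "prob {\<omega>. \<forall>y\<in>?Y. \<omega> ((\<lambda>(i, j). e i + j) y) = (\<lambda>(i, j). u i j) y} =
     (\<Prod>y\<in>?Y. letter_prob ((\<lambda>(i, j). u i j) y))"
    by (intro prob_pattern) (use I in auto)
  also have "{\<omega>. \<forall>y\<in>?Y. \<omega> ((\<lambda>(i, j). e i + j) y) = (\<lambda>(i, j). u i j) y} =
     {\<omega>. \<forall>i\<in>I. \<forall>j<b i. \<omega> (e i + j) = u i j}"
    by auto
  finally show ?thesis using I by (simp add: prod.Sigma case_prod_unfold)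
qed

end

section \<open>Hits along several arithmetic progressions\<close>

text \<open>Discarding \<open>x\<close> hits changes the power of \<open>\<theta>\<close> by at most
  \<open>2 * x\<close>; after integration every such comparison becomes a first moment
  bound.\<close>

lemma norm_power_minus_one_le: "norm (\<theta>::complex) = 1 \<Longrightarrow> norm (\<theta> ^ x - 1) \<le> 2 * real x"
proof -
  assume \<theta>: "norm \<theta> = 1"
  have "norm (\<theta> ^ x - 1 ^ x) \<le> x * norm (\<theta> - 1)" by (rule norm_power_diff) (simp_all add: \<theta>)
  also have "\<dots> \<le> real x * 2" using norm_triangle_ineq4[of \<theta> 1] \<theta> by (intro mult_left_mono) auto
  finally show ?thesis by simp
qed

lemma integral_dist_le:
  fixes F G :: "'a \<Rightarrow> 'b::{banach,second_countable_topology}" and H :: "'a \<Rightarrow> real"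
  assumes "integrable M F" "integrable M G" "integrable M H" "\<And>\<omega>. norm (F \<omega> - G \<omega>) \<le> H \<omega>"
  shows "norm ((\<integral>\<omega>. F \<omega> \<partial>M) - (\<integral>\<omega>. G \<omega> \<partial>M)) \<le> (\<integral>\<omega>. H \<omega> \<partial>M)"
proof -
  have "norm ((\<integral>\<omega>. F \<omega> \<partial>M) - (\<integral>\<omega>. G \<omega> \<partial>M)) = norm (\<integral>\<omega>. F \<omega> - G \<omega> \<partial>M)"
    using assms by simp
  also have "\<dots> \<le> (\<integral>\<omega>. norm (F \<omega> - G \<omega>) \<partial>M)" by (rule integral_norm_bound)
  also have "\<dots> \<le> (\<integral>\<omega>. H \<omega> \<partial>M)" using assms by (intro integral_mono) auto
  finally show ?thesis .
qed

text \<open>\<open>\<alpha>\<close> is the point whose cylinders are to be hit, kept fixed.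
  \<open>c\<close> bounds all letter probabilities at once, so every additional prescribed letter
  costs at least a factor \<open>c < 1\<close>.\<close>

locale multiple_hits = iid_sequence M for M :: "(nat \<Rightarrow> 'a::countable) measure" +
  fixes l :: nat and d :: "nat \<Rightarrow> nat" and \<alpha> :: "nat \<Rightarrow> 'a" and c :: real
  assumes l: "l \<ge> 1" and d_pos: "d 1 \<ge> 1" and d_mono: "strict_mono_on {1..l} d"
    and c_pos: "0 < c" and c_less: "c < 1"
    and letter_pos: "0 < letter_prob a" and letter_le: "letter_prob a \<le> c"
begin

definition cyl_prob :: "nat \<Rightarrow> real" where
  "cyl_prob n = (\<Prod>j<n. letter_prob (\<alpha> j))"

definition all_hit :: "nat \<Rightarrow> nat \<Rightarrow> (nat \<Rightarrow> 'a) \<Rightarrow> bool" where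
  "all_hit n k \<omega> \<longleftrightarrow> (\<forall>i\<in>{1..l}. \<forall>j<n. \<omega> (d i * k + j) = \<alpha> j)"

definition hits :: "nat \<Rightarrow> nat set \<Rightarrow> (nat \<Rightarrow> 'a) \<Rightarrow> nat" where
  "hits n I \<omega> = (\<Sum>m\<in>I. of_bool (all_hit n m \<omega>))"

text \<open>Contains every coordinate read by a hit at any time from \<open>m\<close> to
  \<open>k\<close>, so a single window controls the dependence of a whole run of times.\<close>

definition window :: "nat \<Rightarrow> nat \<Rightarrow> nat \<Rightarrow> nat set" where
  "window m k n = (\<Union>i\<in>{1..l}. {d i * m..<d i * k + n})"

lemma d_less: "i \<in> {1..l} \<Longrightarrow> i' \<in> {1..l} \<Longrightarrow> i < i' \<Longrightarrow> d i + 1 \<le> d i'"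
  using strict_mono_onD[OF d_mono, of i i'] by simp

lemma d_ge1: "i \<in> {1..l} \<Longrightarrow> 1 \<le> d i"
  using d_less[of 1 i] d_pos by (cases "i = 1") auto

lemma d_le_last: "i \<in> {1..l} \<Longrightarrow> d i \<le> d l"
  using d_less[of i l] by (cases "i = l") auto

lemma d_first_le: "i \<in> {1..l} \<Longrightarrow> d 1 \<le> d i"
  using d_less[of 1 i] by (cases "i = 1") auto

lemma finite_window: "finite (window m k n)"
  by (simp add: window_def)

lemma window_mono: "m \<le> m' \<Longrightarrow> k' \<le> k \<Longrightarrow> window m' k' n \<subseteq> window m k n"
  unfolding window_def
  by (intro UN_mono subset_refl) (auto intro!: order_trans[OF mult_le_mono2] elim!: order.strict_trans2)

lemma all_hit_depends: "depends_only (all_hit n k) (window k k n)"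
  unfolding depends_only_def all_hit_def window_def by auto

lemma hits_depends:
  assumes "\<And>m. m \<in> I \<Longrightarrow> window m m n \<subseteq> A"
  shows "depends_only (hits n I) A"
  unfolding hits_def
  by (intro depends_only_sum depends_only_comp[of "all_hit n m" _ of_bool for m]
      depends_only_mono[OF all_hit_depends assms])

lemma all_hit_event: "{\<omega>. all_hit n k \<omega>} \<in> events"
  by (rule depends_only_event[OF finite_window, of _ k k n]) (simp add: all_hit_depends)

lemma all_hit_pair_event: "{\<omega>. all_hit n k \<omega> \<and> all_hit n m \<omega>} \<in> events"
proof -
  have "{\<omega>. all_hit n k \<omega> \<and> all_hit n m \<omega>} = {\<omega>. all_hit n k \<omega>} \<inter> {\<omega>. all_hit n m \<omega>}"
    by auto
  then show ?thesis using all_hit_event by auto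
qed

lemma all_hit_measurable [measurable]:
  "(\<lambda>\<omega>. of_bool (all_hit n k \<omega>) :: 'c::{topological_space,zero_neq_one}) \<in> borel_measurable M"
  by (rule depends_only_measurable[OF finite_window, of _ k k n])
    (intro depends_only_comp[of "all_hit n k" _ of_bool] all_hit_depends)

lemma hits_measurable:
  assumes "finite I"
  shows "(\<lambda>\<omega>. f (hits n I \<omega>) :: 'c::topological_space) \<in> borel_measurable M"
proof (rule depends_only_measurable)
  show "finite (\<Union>m\<in>I. window m m n)" using assms finite_window by auto
  show "depends_only (\<lambda>\<omega>. f (hits n I \<omega>)) (\<Union>m\<in>I. window m m n)"
    by (intro depends_only_comp[of "hits n I" _ f] hits_depends) auto
qed

lemma hits_power_measurable [measurable]:
  "finite I \<Longrightarrow> (\<lambda>\<omega>. (\<theta>::complex) ^ hits n I \<omega>) \<in> borel_measurable M"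
  by (rule hits_measurable)

lemma hits_Un: "finite I \<Longrightarrow> finite J \<Longrightarrow> I \<inter> J = {} \<Longrightarrow> hits n (I \<union> J) \<omega> = hits n I \<omega> + hits n J \<omega>"
  unfolding hits_def by (rule sum.union_disjoint)

lemma integral_of_bool: "{\<omega>. P \<omega>} \<in> events \<Longrightarrow> (\<integral>\<omega>. of_bool (P \<omega>) \<partial>M) = prob {\<omega>. P \<omega>}"
proof -
  assume "{\<omega>. P \<omega>} \<in> events"
  moreover have "(\<lambda>\<omega>. of_bool (P \<omega>) :: real) = indicator {\<omega>. P \<omega>}"
    by (auto simp: indicator_def)
  ultimately show ?thesis by (simp add: space_UNIV)
qed

lemma cyl_prob_pos: "0 < cyl_prob n"
  unfolding cyl_prob_def by (intro prod_pos) (auto simp: letter_pos)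

lemma prod_letter_le: "finite A \<Longrightarrow> (\<Prod>j\<in>A. letter_prob (u j)) \<le> c ^ card A"
  using prod_mono[of A "\<lambda>j. letter_prob (u j)" "\<lambda>_. c"] letter_le letter_prob_nonneg by simp

lemma cyl_prob_le: "cyl_prob n \<le> c ^ n"
  unfolding cyl_prob_def using prod_letter_le[of "{..<n}"] by simp

text \<open>Only the block of the first progression is used, because for small \<open>m\<close> the
  blocks of one time can overlap. The weak bound is enough where \<open>O(n)\<close> times are
  discarded.\<close>

lemma prob_all_hit_le: "prob {\<omega>. all_hit n m \<omega>} \<le> cyl_prob n"
proof -
  have "prob {\<omega>. all_hit n m \<omega>} \<le> prob {\<omega>. \<forall>i\<in>{1}. \<forall>j<n. \<omega> (d i * m + j) = \<alpha> j}"
  proof (rule finite_measure_mono)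
    show "{\<omega>. \<forall>i\<in>{1}. \<forall>j<n. \<omega> (d i * m + j) = \<alpha> j} \<in> events"
      by (rule depends_only_event[of "{d 1 * m..<d 1 * m + n}"]) (auto simp: depends_only_def)
  qed (use l in \<open>auto simp: all_hit_def\<close>)
  also have "\<dots> = cyl_prob n"
    using prob_blocks[of "{1}" "\<lambda>i. d i * m" "\<lambda>_. n" "\<lambda>_ j. \<alpha> j"] by (simp add: cyl_prob_def)
  finally show ?thesis .
qed

text \<open>This is the gain over a single hit that makes joint hits negligible. It holds for all
  \<open>m < k\<close>, however the remaining blocks of \<open>m\<close> overlap those of
  \<open>k\<close>; it serves both the dependent times outside the clump and the short distances at
  an aperiodic point.\<close>

lemma prob_pair_le:
  assumes "n \<le> k" "m < k"
  shows "prob {\<omega>. all_hit n k \<omega> \<and> all_hit n m \<omega>} \<le> cyl_prob n ^ l * c ^ min n (k - m)"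
proof -
  \<comment> \<open>Block \<open>0\<close> is the part of the first block of \<open>m\<close> that lies to the left of all blocks of \<open>k\<close>.\<close>
  define e where "e = (\<lambda>i. if i = 0 then d 1 * m else d i * k)"
  define b where "b = (\<lambda>i::nat. if i = 0 then min n (k - m) else n)"
  have "prob {\<omega>. all_hit n k \<omega> \<and> all_hit n m \<omega>} \<le>
      prob {\<omega>. \<forall>i\<in>{0..l}. \<forall>j<b i. \<omega> (e i + j) = \<alpha> j}"
  proof (rule finite_measure_mono)
    show "{\<omega>. \<forall>i\<in>{0..l}. \<forall>j<b i. \<omega> (e i + j) = \<alpha> j} \<in> events"
      by (rule depends_only_event[of "\<Union>i\<in>{0..l}. {e i..<e i + b i}"]) (auto simp: depends_only_def)
    show "{\<omega>. all_hit n k \<omega> \<and> all_hit n m \<omega>} \<subseteq> {\<omega>. \<forall>i\<in>{0..l}. \<forall>j<b i. \<omega> (e i + j) = \<alpha> j}"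
      using l by (auto simp: all_hit_def e_def b_def)
  qed
  also have "\<dots> = (\<Prod>i\<in>{0..l}. \<Prod>j<b i. letter_prob (\<alpha> j))"
  proof (rule prob_blocks)
    fix i i' assume a: "i \<in> {0..l}" "i' \<in> {0..l}" "i < i'"
    show "e i + b i \<le> e i'"
    proof (cases "i = 0")
      case True
      have "d 1 * m + (k - m) \<le> d 1 * m + d 1 * (k - m)" using d_pos by simp
      also have "\<dots> = d 1 * k"
        using assms(2) by (metis add_mult_distrib2 le_add_diff_inverse less_imp_le)
      also have "\<dots> \<le> d i' * k" using d_first_le a True by (intro mult_le_mono1) auto
      finally show ?thesis using a True by (simp add: e_def b_def)
    next
      case False
      have "d i * k + n \<le> (d i + 1) * k" using assms by simp
      also have "\<dots> \<le> d i' * k" by (intro mult_le_mono1 d_less) (use a False in auto)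
      finally show ?thesis using a False by (simp add: e_def b_def)
    qed
  qed simp
  also have "\<dots> = (\<Prod>j<min n (k - m). letter_prob (\<alpha> j)) * (\<Prod>i\<in>{1..l}. \<Prod>j<b i. letter_prob (\<alpha> j))"
    by (simp add: prod.atLeast_Suc_atMost b_def)
  also have "(\<Prod>i\<in>{1..l}. \<Prod>j<b i. letter_prob (\<alpha> j)) = (\<Prod>i\<in>{1..l}. cyl_prob n)"
    by (intro prod.cong) (auto simp: cyl_prob_def b_def)
  also have "\<dots> = cyl_prob n ^ l" by simp
  also have "(\<Prod>j<min n (k - m). letter_prob (\<alpha> j)) * cyl_prob n ^ l \<le> c ^ min n (k - m) * cyl_prob n ^ l"
    using prod_letter_le[of "{..<min n (k - m)}"] cyl_prob_pos[of n] by (intro mult_right_mono) auto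
  finally show ?thesis by (simp add: mult.commute)
qed

lemma integral_hits: "finite I \<Longrightarrow> (\<integral>\<omega>. real (hits n I \<omega>) \<partial>M) = (\<Sum>m\<in>I. prob {\<omega>. all_hit n m \<omega>})"
proof -
  assume "finite I"
  have "(\<integral>\<omega>. real (hits n I \<omega>) \<partial>M) = (\<integral>\<omega>. (\<Sum>m\<in>I. of_bool (all_hit n m \<omega>)) \<partial>M)"
    by (simp add: hits_def of_nat_sum)
  also have "\<dots> = (\<Sum>m\<in>I. \<integral>\<omega>. of_bool (all_hit n m \<omega>) \<partial>M)"
    by (intro Bochner_Integration.integral_sum integrable_const_bound[where B = 1]) auto
  finally show ?thesis by (simp add: integral_of_bool all_hit_event)
qed

lemma integral_hits_pair:
  "finite I \<Longrightarrow> (\<integral>\<omega>. of_bool (all_hit n k \<omega>) * real (hits n I \<omega>) \<partial>M) =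
     (\<Sum>m\<in>I. prob {\<omega>. all_hit n k \<omega> \<and> all_hit n m \<omega>})"
proof -
  assume "finite I"
  have "(\<integral>\<omega>. of_bool (all_hit n k \<omega>) * real (hits n I \<omega>) \<partial>M) =
     (\<integral>\<omega>. (\<Sum>m\<in>I. of_bool (all_hit n k \<omega>) * of_bool (all_hit n m \<omega>)) \<partial>M)"
    by (simp add: hits_def of_nat_sum sum_distrib_left)
  also have "\<dots> = (\<Sum>m\<in>I. \<integral>\<omega>. of_bool (all_hit n k \<omega>) * of_bool (all_hit n m \<omega>) \<partial>M)"
    by (intro Bochner_Integration.integral_sum integrable_const_bound[where B = 1]) auto
  also have "\<dots> = (\<Sum>m\<in>I. prob {\<omega>. all_hit n k \<omega> \<and> all_hit n m \<omega>})"
    by (intro sum.cong refl) (simp add: integral_of_bool[symmetric] all_hit_pair_event of_bool_conj)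
  finally show ?thesis .
qed

lemma integrable_hits:
  assumes "finite I"
  shows "integrable M (\<lambda>\<omega>. real (hits n I \<omega>))"
    and "integrable M (\<lambda>\<omega>. of_bool (all_hit n k \<omega>) * real (hits n I \<omega>))"
proof -
  have le: "hits n I \<omega> \<le> card I" for \<omega>
    unfolding hits_def using sum_bounded_above[of I "\<lambda>m. of_bool (all_hit n m \<omega>)" "1::nat"] by simp
  have [measurable]: "(\<lambda>\<omega>. real (hits n I \<omega>)) \<in> borel_measurable M"
    using assms by (rule hits_measurable)
  show "integrable M (\<lambda>\<omega>. real (hits n I \<omega>))"
    "integrable M (\<lambda>\<omega>. of_bool (all_hit n k \<omega>) * real (hits n I \<omega>))"
    by (rule integrable_const_bound[where B = "card I"]; simp add: le)+
qed

end

text \<open>Since the multiplier has modulus at most 1, the errors of the single steps only add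
  up.\<close>

lemma linear_recursion_error:
  fixes f :: "nat \<Rightarrow> complex"
  assumes "norm z \<le> 1" and step: "\<And>k. K \<le> k \<Longrightarrow> k < N \<Longrightarrow> norm (f (Suc k) - z * f k) \<le> e"
    and "K \<le> N"
  shows "norm (f N - z ^ (N - K) * f K) \<le> real (N - K) * e"
  using \<open>K \<le> N\<close> step
proof (induction N rule: dec_induct)
  case base
  then show ?case by simp
next
  case (step n)
  have "f (Suc n) - z ^ (Suc n - K) * f K = (f (Suc n) - z * f n) + z * (f n - z ^ (n - K) * f K)"
    using step.hyps by (simp add: Suc_diff_le algebra_simps)
  also have "norm \<dots> \<le> norm (f (Suc n) - z * f n) + norm (z * (f n - z ^ (n - K) * f K))"
    by (rule norm_triangle_ineq)
  also have "norm (f (Suc n) - z * f n) \<le> e" using step by simp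
  also have "norm (z * (f n - z ^ (n - K) * f K)) \<le> 1 * (real (n - K) * e)"
    unfolding norm_mult using step assms(1) by (intro mult_mono) auto
  finally show ?case using step.hyps by (simp add: Suc_diff_le algebra_simps)
qed

section \<open>One step of the recursion for the characteristic function\<close>

context multiple_hits
begin

lemma norm_hits_power: "norm (\<theta>::complex) = 1 \<Longrightarrow> norm (\<theta> ^ hits n I \<omega>) = 1"
  by (simp add: norm_power)

lemma integrable_hits_power:
  "finite I \<Longrightarrow> norm (\<theta>::complex) = 1 \<Longrightarrow> integrable M (\<lambda>\<omega>. \<theta> ^ hits n I \<omega>)"
  by (rule integrable_const_bound[where B = 1]) (auto simp: norm_hits_power)

lemma integrable_hit_hits_power:
  "finite I \<Longrightarrow> norm (\<theta>::complex) = 1 \<Longrightarrow> integrable M (\<lambda>\<omega>. of_bool (all_hit n k \<omega>) * \<theta> ^ hits n I \<omega>)"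
  by (rule integrable_const_bound[where B = 1]) (auto simp: norm_hits_power norm_mult)

lemma norm_integral_hits_power:
  assumes "norm (\<theta>::complex) = 1" shows "norm (\<integral>\<omega>. \<theta> ^ hits n I \<omega> \<partial>M) \<le> 1"
proof -
  have "norm (\<integral>\<omega>. \<theta> ^ hits n I \<omega> \<partial>M) \<le> (\<integral>\<omega>. norm (\<theta> ^ hits n I \<omega>) \<partial>M)"
    by (rule integral_norm_bound)
  also have "\<dots> = 1" using assms prob_space by (simp add: norm_power)
  finally show ?thesis .
qed

text \<open>For fixed \<open>i\<close> and \<open>j\<close> the numbers \<open>d j * m\<close> lie
  in an interval of length at most \<open>d i * L + 2 * n\<close>, which is at most
  \<open>3 * n\<close>, and \<open>m\<close> is determined by \<open>d j * m\<close>. There are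
  \<open>l\<^sup>2\<close> pairs of progressions.\<close>

lemma card_dependent_le:
  assumes "n \<le> k - L" "L \<le> k" "d l * L \<le> n"
  shows "card {m\<in>{1..<k - L}. \<exists>i\<in>{1..l}. \<exists>j\<in>{1..l}. d i * (k - L) < d j * m + n \<and> d j * m < d i * k + n}
     \<le> 3 * l\<^sup>2 * n"
proof -
  let ?B = "\<lambda>i j. {m. d i * (k - L) < d j * m + n \<and> d j * m < d i * k + n}"
  have B: "finite (?B i j) \<and> card (?B i j) \<le> 3 * n" if ij: "i \<in> {1..l}" "j \<in> {1..l}" for i j
  proof -
    let ?J = "{d i * (k - L) + 1 - n..<d i * k + n}"
    have inj: "inj_on ((*) (d j)) (?B i j)"
      using d_ge1[OF ij(2)] by (auto intro: inj_onI)
    have sub: "(*) (d j) ` ?B i j \<subseteq> ?J" by auto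
    have "n \<le> d i * (k - L)"
      using assms(1) d_ge1[OF ij(1)] by (metis mult_le_mono nat_mult_1 le_trans)
    moreover have "d i * k = d i * (k - L) + d i * L"
      using assms(2) by (metis add_mult_distrib2 le_add_diff_inverse2)
    moreover have "d i * L \<le> n"
      using assms(3) d_le_last[OF ij(1)] by (meson le_trans mult_le_mono1)
    ultimately have "card ?J \<le> 3 * n" by simp
    then show ?thesis
      using card_inj_on_le[OF inj sub] inj_on_finite[OF inj sub] by simp
  qed
  have "card {m\<in>{1..<k - L}. \<exists>i\<in>{1..l}. \<exists>j\<in>{1..l}. d i * (k - L) < d j * m + n \<and> d j * m < d i * k + n}
     \<le> card (\<Union>(i, j)\<in>{1..l} \<times> {1..l}. ?B i j)"
    using B by (intro card_mono) (auto simp: case_prod_unfold)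
  also have "\<dots> \<le> (\<Sum>(i, j)\<in>{1..l} \<times> {1..l}. card (?B i j))"
    using card_UN_le[of "{1..l} \<times> {1..l}" "\<lambda>(i, j). ?B i j"] by (simp add: case_prod_unfold)
  also have "\<dots> \<le> (\<Sum>(i, j)\<in>{1..l} \<times> {1..l}. 3 * n)"
    using B by (intro sum_mono) auto
  also have "\<dots> = 3 * l\<^sup>2 * n" by (simp add: power2_eq_square)
  finally show ?thesis .
qed

lemma hits_power_dist_one:
  assumes "finite I" "norm (\<theta>::complex) = 1"
  shows "norm ((\<integral>\<omega>. \<theta> ^ hits n I \<omega> \<partial>M) - 1) \<le> 2 * real (card I) * cyl_prob n"
proof -
  have "norm ((\<integral>\<omega>. \<theta> ^ hits n I \<omega> \<partial>M) - (\<integral>\<omega>. 1 \<partial>M)) \<le> (\<integral>\<omega>. 2 * real (hits n I \<omega>) \<partial>M)"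
    using assms integrable_hits(1)
    by (intro integral_dist_le integrable_hits_power norm_power_minus_one_le) auto
  also have "\<dots> = 2 * (\<Sum>m\<in>I. prob {\<omega>. all_hit n m \<omega>})"
    using assms by (simp add: integral_hits)
  also have "\<dots> \<le> 2 * (real (card I) * cyl_prob n)"
    using sum_bounded_above[of I "\<lambda>m. prob {\<omega>. all_hit n m \<omega>}" "cyl_prob n"] prob_all_hit_le by simp
  finally show ?thesis using prob_space by simp
qed

text \<open>Three replacements lead from the exact increment to the linear one: drop the dependent
  times next to the hit at \<open>k\<close>, factor by independence, and put the dropped times back
  into the unconditioned expectation. Each costs \<open>q\<close> times a quantity that vanishes for
  a suitable \<open>L\<close>; \<open>\<epsilon>\<close> and \<open>\<gamma>\<close> carry what is
  special about the clump.\<close>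

lemma step_error:
  fixes \<theta> \<gamma> :: complex
  assumes \<theta>: "norm \<theta> = 1" and n: "1 \<le> n" and k: "2 * n \<le> k" and L: "d l * L \<le> n"
    and near: "norm ((\<integral>\<omega>. of_bool (all_hit n k \<omega>) * \<theta> ^ hits n {k - L..<k} \<omega> \<partial>M) - of_real (cyl_prob n ^ l) * \<gamma>)
      \<le> cyl_prob n ^ l * \<epsilon>"
  shows "norm ((\<integral>\<omega>. \<theta> ^ hits n {1..k} \<omega> \<partial>M)
      - (1 - (1 - \<theta>) * \<gamma> * of_real (cyl_prob n ^ l)) * (\<integral>\<omega>. \<theta> ^ hits n {1..<k} \<omega> \<partial>M))
     \<le> cyl_prob n ^ l * (2 * (\<epsilon> + 6 * (real l)\<^sup>2 * real n * c ^ L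
         + norm \<gamma> * (2 * (real L + 3 * (real l)\<^sup>2 * real n) * cyl_prob n)))"
proof -
  define q where "q = cyl_prob n ^ l"
  have q: "0 \<le> q" using cyl_prob_pos[of n] by (simp add: q_def)
  have Ln: "L \<le> n" using L d_ge1[of l] l by (metis atLeastAtMost_iff le_refl le_trans mult_le_mono1 nat_mult_1)
  have kL: "n \<le> k - L" "L \<le> k" "1 \<le> k - L" using k Ln n by auto
  \<comment> \<open>The condition says that a block of \<open>m\<close> meets the window of the
    times from \<open>k - L\<close> to \<open>k\<close>; excluding these times is exactly what makes
    \<open>far\<close> independent of the clump.\<close>
  define mid where "mid = {m\<in>{1..<k - L}. \<exists>i\<in>{1..l}. \<exists>j\<in>{1..l}. d i * (k - L) < d j * m + n \<and> d j * m < d i * k + n}"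
  define far where "far = {1..<k - L} - mid"
  define near_set where "near_set = {k - L..<k}"
  have fin [simp]: "finite mid" "finite far" "finite near_set"
    by (auto simp: mid_def far_def near_set_def)
  have split: "{1..<k} = near_set \<union> (mid \<union> far)" "near_set \<inter> (mid \<union> far) = {}" "mid \<inter> far = {}"
    using kL by (auto simp: near_set_def far_def mid_def)
  have card_mid: "real (card mid) \<le> 3 * (real l)\<^sup>2 * real n"
    using of_nat_mono[OF card_dependent_le[OF kL(1,2) L], where 'a = real]
    unfolding mid_def[symmetric] by simp
  have k_split: "{1..k} = {1..<k} \<union> {k}" "{1..<k} \<inter> {k} = {}" using kL by auto
  let ?X = "\<lambda>\<omega>. of_bool (all_hit n k \<omega>) :: complex"
  let ?A = "\<lambda>\<omega>. \<theta> ^ hits n near_set \<omega>" and ?B = "\<lambda>\<omega>. \<theta> ^ hits n mid \<omega>" and ?C = "\<lambda>\<omega>. \<theta> ^ hits n far \<omega>"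
  have prod: "\<theta> ^ hits n {1..<k} \<omega> = ?A \<omega> * ?B \<omega> * ?C \<omega>" for \<omega>
    unfolding split(1) using split(2,3) by (simp add: hits_Un power_add)
  \<comment> \<open>The indicator \<open>X\<close> of a hit at \<open>k\<close> takes only the
    values 0 and 1, so its contribution to the power is
    \<open>1 - (1 - \<theta>) * X\<close>.\<close>
  have step: "\<theta> ^ hits n {1..k} \<omega> = \<theta> ^ hits n {1..<k} \<omega> - (1 - \<theta>) * (?X \<omega> * \<theta> ^ hits n {1..<k} \<omega>)" for \<omega>
    unfolding k_split(1) using k_split(2)
    by (subst hits_Un) (auto simp: power_add hits_def algebra_simps)
  define E0 where "E0 = (\<integral>\<omega>. \<theta> ^ hits n {1..<k} \<omega> \<partial>M)"
  define E1 where "E1 = (\<integral>\<omega>. ?X \<omega> * \<theta> ^ hits n {1..<k} \<omega> \<partial>M)"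
  define E2 where "E2 = (\<integral>\<omega>. ?X \<omega> * ?A \<omega> \<partial>M)"
  define E3 where "E3 = (\<integral>\<omega>. ?C \<omega> \<partial>M)"
  have Ek: "(\<integral>\<omega>. \<theta> ^ hits n {1..k} \<omega> \<partial>M) = E0 - (1 - \<theta>) * E1"
    unfolding step E0_def E1_def
    by (simp add: integrable_hit_hits_power integrable_hits_power \<theta>)
  \<comment> \<open>The hit at \<open>k\<close> and its near hits read letters in one window, the
    far hits read letters outside it.\<close>
  have XAC: "(\<integral>\<omega>. ?X \<omega> * ?A \<omega> * ?C \<omega> \<partial>M) = E2 * E3"
    unfolding E2_def E3_def
  proof (rule depends_only_integral_mult)
    show "finite (window (k - L) k n)" "finite (\<Union>m\<in>far. window m m n)"
      by (auto simp: finite_window)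
    show "depends_only (\<lambda>\<omega>. ?X \<omega> * ?A \<omega>) (window (k - L) k n)"
    proof (rule depends_only_comp2[where h = "(*)"])
      show "depends_only ?X (window (k - L) k n)"
        by (rule depends_only_comp[of "all_hit n k" _ of_bool])
          (rule depends_only_mono[OF all_hit_depends window_mono], auto)
      show "depends_only ?A (window (k - L) k n)"
        by (rule depends_only_comp[of "hits n near_set"])
          (rule hits_depends, rule window_mono, auto simp: near_set_def)
    qed
    show "depends_only ?C (\<Union>m\<in>far. window m m n)"
      by (rule depends_only_comp[of "hits n far"]) (rule hits_depends, auto)
    show "window (k - L) k n \<inter> (\<Union>m\<in>far. window m m n) = {}"
    proof (rule ccontr)
      assume "window (k - L) k n \<inter> (\<Union>m\<in>far. window m m n) \<noteq> {}"
      then obtain x m where x: "m \<in> far" "x \<in> window (k - L) k n" "x \<in> window m m n" by blast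
      obtain i where i: "i \<in> {1..l}" "d i * (k - L) \<le> x" "x < d i * k + n"
        using x(2) unfolding window_def by fastforce
      obtain j where j: "j \<in> {1..l}" "d j * m \<le> x" "x < d j * m + n"
        using x(3) unfolding window_def by fastforce
      have "d i * (k - L) < d j * m + n" "d j * m < d i * k + n" using i j by auto
      with x(1) i(1) j(1) have "m \<in> mid" unfolding far_def mid_def by blast
      with x(1) show False by (simp add: far_def)
    qed
  qed (auto simp: norm_mult norm_power \<theta>)
  \<comment> \<open>Times in \<open>mid\<close> are more than \<open>L\<close> before
    \<open>k\<close>, so each joint hit has probability at most \<open>q * c ^ L\<close>.\<close>
  have e1: "norm (E1 - E2 * E3) \<le> 6 * (real l)\<^sup>2 * real n * (q * c ^ L)"
  proof -
    have "norm (E1 - (\<integral>\<omega>. ?X \<omega> * ?A \<omega> * ?C \<omega> \<partial>M)) \<le>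
       (\<integral>\<omega>. 2 * (of_bool (all_hit n k \<omega>) * real (hits n mid \<omega>)) \<partial>M)"
      unfolding E1_def
    proof (rule integral_dist_le)
      have "(\<lambda>\<omega>. ?X \<omega> * ?A \<omega> * ?C \<omega>) = (\<lambda>\<omega>. ?X \<omega> * \<theta> ^ hits n (near_set \<union> far) \<omega>)"
        using split by (subst hits_Un) (auto simp: power_add mult.assoc)
      then show "integrable M (\<lambda>\<omega>. ?X \<omega> * ?A \<omega> * ?C \<omega>)"
        by (simp add: integrable_hit_hits_power \<theta>)
      fix \<omega>
      have "?X \<omega> * \<theta> ^ hits n {1..<k} \<omega> - ?X \<omega> * ?A \<omega> * ?C \<omega> = ?X \<omega> * ?A \<omega> * ?C \<omega> * (?B \<omega> - 1)"
        unfolding prod by (simp add: algebra_simps)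
      then have "norm (?X \<omega> * \<theta> ^ hits n {1..<k} \<omega> - ?X \<omega> * ?A \<omega> * ?C \<omega>)
          = of_bool (all_hit n k \<omega>) * norm (?B \<omega> - 1)"
        by (simp add: norm_mult norm_power \<theta>)
      also have "\<dots> \<le> of_bool (all_hit n k \<omega>) * (2 * real (hits n mid \<omega>))"
        by (intro mult_left_mono norm_power_minus_one_le \<theta>) auto
      finally show "norm (?X \<omega> * \<theta> ^ hits n {1..<k} \<omega> - ?X \<omega> * ?A \<omega> * ?C \<omega>)
        \<le> 2 * (of_bool (all_hit n k \<omega>) * real (hits n mid \<omega>))" by (simp add: mult_ac)
    qed (use integrable_hits(2)[of mid] in \<open>auto simp: integrable_hit_hits_power \<theta>\<close>)
    also have "\<dots> = 2 * (\<Sum>m\<in>mid. prob {\<omega>. all_hit n k \<omega> \<and> all_hit n m \<omega>})"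
      by (simp add: integral_hits_pair)
    also have "(\<Sum>m\<in>mid. prob {\<omega>. all_hit n k \<omega> \<and> all_hit n m \<omega>}) \<le> real (card mid) * (q * c ^ L)"
    proof (rule sum_bounded_above)
      fix m assume m: "m \<in> mid"
      then have "prob {\<omega>. all_hit n k \<omega> \<and> all_hit n m \<omega>} \<le> q * c ^ min n (k - m)"
        unfolding q_def using kL k by (intro prob_pair_le) (auto simp: mid_def)
      also have "\<dots> \<le> q * c ^ L"
        using m c_pos c_less q Ln by (intro mult_left_mono power_decreasing) (auto simp: mid_def)
      finally show "prob {\<omega>. all_hit n k \<omega> \<and> all_hit n m \<omega>} \<le> q * c ^ L" .
    qed
    also have "real (card mid) * (q * c ^ L) \<le> 3 * (real l)\<^sup>2 * real n * (q * c ^ L)"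
      using card_mid q c_pos by (intro mult_right_mono) auto
    finally show ?thesis unfolding XAC by simp
  qed
  \<comment> \<open>No hit at \<open>k\<close> is present here and the factor \<open>q\<close> is
    supplied from outside, so the bound \<open>cyl_prob n\<close> for each discarded time
    suffices.\<close>
  have e2: "norm (E3 - E0) \<le> 2 * (real L + 3 * (real l)\<^sup>2 * real n) * cyl_prob n"
  proof -
    have "norm (E3 - E0) \<le> (\<integral>\<omega>. 2 * real (hits n (near_set \<union> mid) \<omega>) \<partial>M)"
      unfolding E3_def E0_def
    proof (rule integral_dist_le)
      fix \<omega>
      have "?A \<omega> * ?B \<omega> = \<theta> ^ hits n (near_set \<union> mid) \<omega>"
        using split by (subst hits_Un) (auto simp: power_add)
      then have "?C \<omega> - \<theta> ^ hits n {1..<k} \<omega> = - ?C \<omega> * (\<theta> ^ hits n (near_set \<union> mid) \<omega> - 1)"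
        unfolding prod by (simp add: algebra_simps)
      then have "norm (?C \<omega> - \<theta> ^ hits n {1..<k} \<omega>) = norm (\<theta> ^ hits n (near_set \<union> mid) \<omega> - 1)"
        by (simp add: norm_mult norm_power \<theta>)
      then show "norm (?C \<omega> - \<theta> ^ hits n {1..<k} \<omega>) \<le> 2 * real (hits n (near_set \<union> mid) \<omega>)"
        using norm_power_minus_one_le[OF \<theta>] by simp
    qed (use integrable_hits(1)[of "near_set \<union> mid"] in \<open>auto simp: integrable_hits_power \<theta>\<close>)
    also have "\<dots> = 2 * (\<Sum>m\<in>near_set \<union> mid. prob {\<omega>. all_hit n m \<omega>})"
      by (simp add: integral_hits)
    also have "\<dots> \<le> 2 * (real (card (near_set \<union> mid)) * cyl_prob n)"
      by (intro mult_left_mono sum_bounded_above prob_all_hit_le) auto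
    also have "\<dots> \<le> 2 * ((real L + 3 * (real l)\<^sup>2 * real n) * cyl_prob n)"
    proof (intro mult_left_mono mult_right_mono)
      have "real (card (near_set \<union> mid)) \<le> real (card near_set) + real (card mid)"
        by (metis card_Un_le of_nat_add of_nat_le_iff)
      then show "real (card (near_set \<union> mid)) \<le> real L + 3 * (real l)\<^sup>2 * real n"
        using card_mid kL by (simp add: near_set_def)
    qed (use cyl_prob_pos[of n] in auto)
    finally show ?thesis by (simp only: mult.assoc)
  qed
  have e3: "norm (E2 - of_real q * \<gamma>) \<le> q * \<epsilon>"
    using near by (simp add: E2_def near_set_def q_def)
  have E3_le: "norm E3 \<le> 1" unfolding E3_def by (rule norm_integral_hits_power[OF \<theta>])
  \<comment> \<open>Telescoping through \<open>E2 * E3\<close> and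
    \<open>of_real q * \<gamma> * E3\<close>, one bracket for each of \<open>e1\<close>,
    \<open>e3\<close> and \<open>e2\<close>.\<close>
  have "E0 - (1 - \<theta>) * E1 - (1 - (1 - \<theta>) * \<gamma> * of_real q) * E0 =
     - (1 - \<theta>) * ((E1 - E2 * E3) + (E2 - of_real q * \<gamma>) * E3 + of_real q * \<gamma> * (E3 - E0))"
    by (simp add: algebra_simps)
  also have "norm \<dots> = norm (1 - \<theta>) * norm ((E1 - E2 * E3) + (E2 - of_real q * \<gamma>) * E3 + of_real q * \<gamma> * (E3 - E0))"
    by (simp only: norm_mult norm_minus_cancel)
  also have "\<dots> \<le> 2 * (6 * (real l)\<^sup>2 * real n * (q * c ^ L) + q * \<epsilon> + q * norm \<gamma> * (2 * (real L + 3 * (real l)\<^sup>2 * real n) * cyl_prob n))"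
  proof (rule mult_mono)
    show "norm (1 - \<theta>) \<le> 2" using norm_triangle_ineq4[of 1 \<theta>] \<theta> by simp
    have "norm ((E2 - of_real q * \<gamma>) * E3) \<le> q * \<epsilon> * 1"
      unfolding norm_mult using e3 E3_le norm_ge_zero order_trans by (intro mult_mono) (blast | simp)+
    moreover have "norm (of_real q * \<gamma> * (E3 - E0)) \<le> q * norm \<gamma> * (2 * (real L + 3 * (real l)\<^sup>2 * real n) * cyl_prob n)"
      using e2 q by (simp add: norm_mult mult_left_mono mult.assoc)
    ultimately show "norm ((E1 - E2 * E3) + (E2 - of_real q * \<gamma>) * E3 + of_real q * \<gamma> * (E3 - E0)) \<le>
      6 * (real l)\<^sup>2 * real n * (q * c ^ L) + q * \<epsilon> + q * norm \<gamma> * (2 * (real L + 3 * (real l)\<^sup>2 * real n) * cyl_prob n)"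
      using e1 by (intro norm_triangle_le add_mono) auto
  qed auto
  finally show ?thesis
    unfolding Ek q_def[symmetric] E0_def[symmetric] by (simp add: algebra_simps)
qed

end

section \<open>Limit of the characteristic functions\<close>

text \<open>Differentiability of the exponential at 0 along \<open>q n\<close>. It permits replacing
  the multiplier \<open>1 - a * q\<close> by \<open>exp (- (a * q))\<close>, whose modulus is at
  most 1 when \<open>Re a >= 0\<close> and whose powers are explicit, at a cost of
  \<open>o(q)\<close> per step.\<close>

lemma exp_minus_linear_quotient_tendsto:
  fixes a :: complex and q :: "nat \<Rightarrow> real"
  assumes "q \<longlonglongrightarrow> 0" "\<And>n. q n > 0"
  shows "(\<lambda>n. norm (exp (- (a * of_real (q n))) - (1 - a * of_real (q n))) / q n) \<longlonglongrightarrow> 0"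
proof -
  have "((\<lambda>h. exp (- (a * h))) has_field_derivative - a) (at 0)"
    by (auto intro!: derivative_eq_intros)
  then have D: "((\<lambda>h. (exp (- (a * h)) - 1) / h) \<longlongrightarrow> - a) (at 0)"
    by (simp add: has_field_derivative_iff)
  have "filterlim (\<lambda>n. complex_of_real (q n)) (at 0) sequentially"
  proof (rule filterlim_atI)
    show "(\<lambda>n. complex_of_real (q n)) \<longlonglongrightarrow> 0"
      using tendsto_of_real[OF assms(1), where 'a = complex] by simp
    show "\<forall>\<^sub>F n in sequentially. complex_of_real (q n) \<noteq> 0"
      using assms(2) by (simp add: less_imp_neq[symmetric])
  qed
  from filterlim_compose[OF D this]
  have "(\<lambda>n. (exp (- (a * of_real (q n))) - 1) / of_real (q n) - (- a)) \<longlonglongrightarrow> - a - (- a)"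
    by (intro tendsto_diff tendsto_const)
  then have "(\<lambda>n. norm ((exp (- (a * of_real (q n))) - 1) / of_real (q n) + a)) \<longlonglongrightarrow> 0"
    by (simp add: tendsto_norm_zero)
  moreover have "norm ((exp (- (a * of_real (q n))) - 1) / of_real (q n) + a) =
      norm (exp (- (a * of_real (q n))) - (1 - a * of_real (q n))) / q n" for n
  proof -
    have "(exp (- (a * of_real (q n))) - 1) / of_real (q n) + a =
       (exp (- (a * of_real (q n))) - (1 - a * of_real (q n))) / of_real (q n)"
      using assms(2)[of n] by (simp add: field_simps)
    then show ?thesis using assms(2)[of n] by (simp add: norm_divide)
  qed
  ultimately show ?thesis by simp
qed

lemma filterlim_div_sequentially:
  "0 < D \<Longrightarrow> filterlim (\<lambda>n::nat. n div D) sequentially sequentially"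
  unfolding filterlim_at_top
proof
  fix Z assume "0 < D"
  show "\<forall>\<^sub>F n in sequentially. Z \<le> n div D"
    using eventually_ge_at_top[of "Z * D"]
    by eventually_elim (use \<open>0 < D\<close> in \<open>simp add: less_eq_div_iff_mult_less_eq\<close>)
qed

lemma linear_times_power_div_tendsto:
  fixes c :: real
  assumes "0 < c" "c < 1" "0 < D"
  shows "(\<lambda>n. real n * c ^ (n div D)) \<longlonglongrightarrow> 0"
proof (rule tendsto_sandwich[OF _ _ tendsto_const])
  show "\<forall>\<^sub>F n in sequentially. 0 \<le> real n * c ^ (n div D)" using assms by auto
  have "n \<le> D * (n div D + 1)" for n
    using assms(3) by (metis Suc_eq_plus1 dividend_less_times_div less_imp_le mult_Suc_right add.commute)
  then have n: "real n \<le> real D * (real (n div D) + 1)" for n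
    by (metis of_nat_1 of_nat_add of_nat_le_iff of_nat_mult)
  then show "\<forall>\<^sub>F n in sequentially. real n * c ^ (n div D) \<le>
     real D * (real (n div D) * c ^ (n div D) + c ^ (n div D))"
    using assms mult_right_mono[OF n, of "c ^ (n div D)" for n] by (auto simp: algebra_simps)
  have D: "filterlim (\<lambda>n. n div D) sequentially sequentially"
    using assms(3) by (rule filterlim_div_sequentially)
  have "(\<lambda>n. real D * (real n * c ^ n + c ^ n)) \<longlonglongrightarrow> real D * (0 + 0)"
    using assms by (intro tendsto_intros powser_times_n_limit_0 LIMSEQ_power_zero) auto
  from filterlim_compose[OF this D]
  show "(\<lambda>n. real D * (real (n div D) * c ^ (n div D) + c ^ (n div D))) \<longlonglongrightarrow> 0" by simp
qed

section \<open>Scales in \<open>n\<close> and the limit of the recursion\<close>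

context multiple_hits
begin

text \<open>Hits at distance at most \<open>lag n\<close> are treated as one clump. It is small enough that the two
  corresponding blocks of letters overlap by at least \<open>n / 2\<close> in each progression.\<close>

definition lag :: "nat \<Rightarrow> nat" where
  "lag n = n div (2 * d l)"

definition obs_time :: "real \<Rightarrow> nat \<Rightarrow> nat" where
  "obs_time t n = nat \<lfloor>t * cyl_prob n powi (- int l)\<rfloor>"

lemma d_last_pos: "0 < d l"
  using d_ge1[of l] l by auto

lemma lag_le: "d l * lag n \<le> n div 2"
  using d_last_pos unfolding lag_def
  by (metis div_mult2_eq times_div_less_eq_dividend)

lemma cyl_prob_le_1: "cyl_prob n \<le> 1"
  using cyl_prob_le[of n] c_pos c_less by (meson less_imp_le order_trans power_le_one)

lemma cyl_prob_power_le: "cyl_prob n ^ l \<le> cyl_prob n"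
  using cyl_prob_pos[of n] cyl_prob_le_1[of n] l
  by (metis less_imp_le power_decreasing power_one_right)

lemma n_cyl_prob_tendsto: "(\<lambda>n. real n * cyl_prob n) \<longlonglongrightarrow> 0"
proof (rule tendsto_sandwich[OF _ _ tendsto_const])
  show "(\<lambda>n. real n * c ^ n) \<longlonglongrightarrow> 0"
    using c_pos c_less by (intro powser_times_n_limit_0) auto
qed (auto intro!: always_eventually mult_left_mono cyl_prob_le simp: less_imp_le[OF cyl_prob_pos])

lemma cyl_prob_tendsto: "cyl_prob \<longlonglongrightarrow> 0"
proof (rule tendsto_sandwich[OF _ _ tendsto_const])
  show "(\<lambda>n. c ^ n) \<longlonglongrightarrow> 0"
    using c_pos c_less by (intro LIMSEQ_power_zero) auto
qed (auto intro!: always_eventually cyl_prob_le simp: less_imp_le[OF cyl_prob_pos])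

lemma obs_time_bounds:
  assumes "t > 0"
  shows "real (obs_time t n) * cyl_prob n ^ l \<le> t"
    and "t - cyl_prob n ^ l \<le> real (obs_time t n) * cyl_prob n ^ l"
proof -
  have q: "0 < cyl_prob n ^ l" using cyl_prob_pos by simp
  have eq: "t * cyl_prob n powi (- int l) = t / cyl_prob n ^ l"
    by (simp add: power_int_minus divide_inverse)
  have nn: "0 \<le> t / cyl_prob n ^ l" using assms q by simp
  have "real (obs_time t n) = of_int \<lfloor>t / cyl_prob n ^ l\<rfloor>"
    unfolding obs_time_def eq using nn by simp
  then have "real (obs_time t n) \<le> t / cyl_prob n ^ l" "t / cyl_prob n ^ l - 1 \<le> real (obs_time t n)"
    by linarith+
  then show "real (obs_time t n) * cyl_prob n ^ l \<le> t"
    "t - cyl_prob n ^ l \<le> real (obs_time t n) * cyl_prob n ^ l"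
    using q by (simp_all add: field_simps)
qed

lemma obs_time_tendsto:
  assumes "t > 0"
  shows "(\<lambda>n. real (obs_time t n) * cyl_prob n ^ l) \<longlonglongrightarrow> t"
proof (rule tendsto_sandwich[OF _ _ _ tendsto_const])
  show "\<forall>\<^sub>F n in sequentially. t - cyl_prob n \<le> real (obs_time t n) * cyl_prob n ^ l"
    using obs_time_bounds(2)[OF assms] cyl_prob_power_le
    by (intro always_eventually) (meson diff_left_mono order_trans)
  show "(\<lambda>n. t - cyl_prob n) \<longlonglongrightarrow> t"
    using tendsto_diff[OF tendsto_const cyl_prob_tendsto, of t] by simp
qed (use obs_time_bounds(1)[OF assms] in auto)

text \<open>The common core of both cases: the structure of \<open>\<alpha>\<close> enters only
  through the clump estimate \<open>near\<close> and its limit \<open>\<gamma>\<close>.\<close>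

lemma hits_power_limit:
  fixes \<theta> \<gamma> :: complex and \<epsilon> :: "nat \<Rightarrow> real"
  assumes \<theta>: "norm \<theta> = 1" and Re: "0 \<le> Re ((1 - \<theta>) * \<gamma>)" and t: "t > 0"
    and \<epsilon>: "\<epsilon> \<longlonglongrightarrow> 0"
    and near: "\<forall>\<^sub>F n in sequentially. \<forall>k\<ge>2 * n.
      norm ((\<integral>\<omega>. of_bool (all_hit n k \<omega>) * \<theta> ^ hits n {k - lag n..<k} \<omega> \<partial>M) - of_real (cyl_prob n ^ l) * \<gamma>)
        \<le> cyl_prob n ^ l * \<epsilon> n"
  shows "(\<lambda>n. \<integral>\<omega>. \<theta> ^ hits n {1..obs_time t n} \<omega> \<partial>M) \<longlonglongrightarrow> exp (- (of_real t * (1 - \<theta>) * \<gamma>))"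
proof -
  define a where "a = (1 - \<theta>) * \<gamma>"
  define q where "q n = cyl_prob n ^ l" for n
  have q_pos: "0 < q n" for n using cyl_prob_pos by (simp add: q_def)
  have q0: "q \<longlonglongrightarrow> 0"
    by (rule tendsto_sandwich[OF _ _ tendsto_const cyl_prob_tendsto])
      (auto intro!: always_eventually simp: less_imp_le[OF q_pos] q_def cyl_prob_power_le less_imp_le[OF cyl_prob_pos])
  define N where "N = obs_time t"
  define f where "f n k = (\<integral>\<omega>. \<theta> ^ hits n {1..k} \<omega> \<partial>M)" for n k
  define z where "z n = exp (- (a * of_real (q n)))" for n
  define e1 where "e1 n = 2 * (\<epsilon> n + 6 * (real l)\<^sup>2 * real n * c ^ lag n
         + norm \<gamma> * (2 * (real (lag n) + 3 * (real l)\<^sup>2 * real n) * cyl_prob n))" for n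
  define e2 where "e2 n = norm (exp (- (a * of_real (q n))) - (1 - a * of_real (q n))) / q n" for n
  have lag_le_n: "lag n \<le> n" for n unfolding lag_def by simp
  have e2_lim: "e2 \<longlonglongrightarrow> 0"
    unfolding e2_def by (rule exp_minus_linear_quotient_tendsto[OF q0 q_pos])
  have e1_lim: "e1 \<longlonglongrightarrow> 0"
  proof -
    have 1: "(\<lambda>n. real n * c ^ lag n) \<longlonglongrightarrow> 0"
      unfolding lag_def using linear_times_power_div_tendsto[OF c_pos c_less, of "2 * d l"] d_last_pos by simp
    have 2: "(\<lambda>n. real (lag n) * cyl_prob n) \<longlonglongrightarrow> 0"
      by (rule tendsto_sandwich[OF _ _ tendsto_const n_cyl_prob_tendsto])
        (auto intro!: always_eventually mult_right_mono simp: less_imp_le[OF cyl_prob_pos] lag_le_n)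
    have "(\<lambda>n. 2 * (\<epsilon> n + 6 * (real l)\<^sup>2 * (real n * c ^ lag n)
         + norm \<gamma> * (2 * (real (lag n) * cyl_prob n + 3 * (real l)\<^sup>2 * (real n * cyl_prob n)))))
       \<longlonglongrightarrow> 2 * (0 + 6 * (real l)\<^sup>2 * 0 + norm \<gamma> * (2 * (0 + 3 * (real l)\<^sup>2 * 0)))"
      by (intro tendsto_intros \<epsilon> 1 2 n_cyl_prob_tendsto)
    then show ?thesis unfolding e1_def by (simp add: algebra_simps)
  qed
  have z_le: "norm (z n) \<le> 1" for n
    using Re q_pos[of n] by (simp add: z_def a_def mult_nonneg_nonneg less_imp_le)
  have Nq: "(\<lambda>n. real (N n) * q n) \<longlonglongrightarrow> t"
    unfolding N_def q_def by (rule obs_time_tendsto[OF t])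
  have nq: "(\<lambda>n. real (2 * n) * q n) \<longlonglongrightarrow> 0"
  proof (rule tendsto_sandwich[OF _ _ tendsto_const])
    show "(\<lambda>n. 2 * (real n * cyl_prob n)) \<longlonglongrightarrow> 0"
      using tendsto_mult_left[OF n_cyl_prob_tendsto, of 2] by simp
  qed (auto intro!: always_eventually mult_left_mono simp: less_imp_le[OF q_pos] q_def cyl_prob_power_le mult.assoc less_imp_le[OF cyl_prob_pos])
  have "(\<lambda>n. real (N n) * q n - real (2 * n) * q n) \<longlonglongrightarrow> t - 0"
    by (intro tendsto_diff Nq nq)
  then have "\<forall>\<^sub>F n in sequentially. 0 < real (N n) * q n - real (2 * n) * q n"
    using t by (auto dest: order_tendstoD)
  then have N_large: "\<forall>\<^sub>F n in sequentially. 2 * n \<le> N n"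
  proof eventually_elim
    case (elim n)
    then have "real (2 * n) * q n < real (N n) * q n" by simp
    then have "real (2 * n) < real (N n)" using q_pos[of n] by (simp only: mult_less_cancel_right_pos)
    then show ?case by linarith
  qed
  have step: "norm (f n (Suc k) - z n * f n k) \<le> q n * (e1 n + e2 n)"
    if "1 \<le> n" "2 * n \<le> k" and near_k: "\<forall>k\<ge>2 * n.
      norm ((\<integral>\<omega>. of_bool (all_hit n k \<omega>) * \<theta> ^ hits n {k - lag n..<k} \<omega> \<partial>M) - of_real (cyl_prob n ^ l) * \<gamma>)
        \<le> cyl_prob n ^ l * \<epsilon> n" for n k
  proof -
    \<comment> \<open>The step estimate is used at time \<open>Suc k\<close>, whose earlier times
      are exactly \<open>{1..k}\<close>.\<close>
    have "norm (f n (Suc k) - (1 - a * of_real (q n)) * f n k) \<le> q n * e1 n"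
      using step_error[OF \<theta> that(1) _ _ near_k[rule_format], of "Suc k"] that(2) lag_le[of n]
      unfolding f_def a_def e1_def q_def by (simp add: atLeastLessThanSuc_atLeastAtMost)
    moreover have "norm ((1 - a * of_real (q n)) * f n k - z n * f n k) \<le> q n * e2 n"
    proof -
      have "norm ((1 - a * of_real (q n)) * f n k - z n * f n k) =
         norm (z n - (1 - a * of_real (q n))) * norm (f n k)"
        by (metis left_diff_distrib norm_minus_commute norm_mult)
      also have "\<dots> \<le> norm (z n - (1 - a * of_real (q n))) * 1"
        unfolding f_def by (intro mult_left_mono norm_integral_hits_power \<theta>) auto
      finally show ?thesis using q_pos[of n] by (simp add: e2_def z_def)
    qed
    ultimately show ?thesis
      using norm_diff_triangle_le by (fastforce simp: distrib_left)
  qed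
  have "\<forall>\<^sub>F n in sequentially. norm (f n (N n) - z n ^ (N n - 2 * n) * f n (2 * n)) \<le> t * (e1 n + e2 n)"
    using near N_large eventually_ge_at_top[of 1]
  proof eventually_elim
    case (elim n)
    have st: "norm (f n (Suc k) - z n * f n k) \<le> q n * (e1 n + e2 n)" if "2 * n \<le> k" for k
      using step elim that by blast
    \<comment> \<open>The sign of \<open>\<epsilon> n\<close> is not assumed; nonnegativity of the
      total error follows because it bounds a norm.\<close>
    then have nn: "0 \<le> e1 n + e2 n"
      using order_trans[OF norm_ge_zero st[OF order_refl]] q_pos[of n] by (simp add: zero_le_mult_iff)
    have "norm (f n (N n) - z n ^ (N n - 2 * n) * f n (2 * n)) \<le> real (N n - 2 * n) * (q n * (e1 n + e2 n))"
      by (rule linear_recursion_error[OF z_le]) (use st elim in auto)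
    also have "\<dots> \<le> real (N n) * (q n * (e1 n + e2 n))"
      using nn q_pos[of n] by (intro mult_right_mono) auto
    also have "\<dots> = real (N n) * q n * (e1 n + e2 n)" by simp
    also have "\<dots> \<le> t * (e1 n + e2 n)"
      using obs_time_bounds(1)[OF t, of n] nn by (intro mult_right_mono) (auto simp: N_def q_def)
    finally show ?case .
  qed
  moreover have "(\<lambda>n. t * (e1 n + e2 n)) \<longlonglongrightarrow> 0"
    using tendsto_mult_left[OF tendsto_add[OF e1_lim e2_lim], of t] by simp
  ultimately have "(\<lambda>n. f n (N n) - z n ^ (N n - 2 * n) * f n (2 * n)) \<longlonglongrightarrow> 0"
    by (rule Lim_null_comparison)
  moreover have "(\<lambda>n. z n ^ (N n - 2 * n) * f n (2 * n)) \<longlonglongrightarrow> exp (- (a * of_real t)) * 1"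
  proof (rule tendsto_mult)
    \<comment> \<open>The power of \<open>z n\<close> is a single exponential with exponent
      proportional to \<open>(N n - 2 * n) * q n\<close>, and this product tends to
      \<open>t\<close>.\<close>
    have "(\<lambda>n. exp (- (a * of_real (real (N n) * q n - real (2 * n) * q n)))) \<longlonglongrightarrow> exp (- (a * of_real (t - 0)))"
      by (intro tendsto_intros Nq nq)
    moreover have "\<forall>\<^sub>F n in sequentially. exp (- (a * of_real (real (N n) * q n - real (2 * n) * q n))) = z n ^ (N n - 2 * n)"
      using N_large
    proof eventually_elim
      case (elim n)
      then show ?case unfolding z_def exp_of_nat_mult[symmetric]
        by (intro arg_cong[where f = exp]) (simp add: of_nat_diff algebra_simps)
    qed
    ultimately show "(\<lambda>n. z n ^ (N n - 2 * n)) \<longlonglongrightarrow> exp (- (a * of_real t))"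
      by (simp add: tendsto_cong)
    have "(\<lambda>n. f n (2 * n) - 1) \<longlonglongrightarrow> 0"
    proof (rule Lim_null_comparison)
      show "\<forall>\<^sub>F n in sequentially. norm (f n (2 * n) - 1) \<le> 4 * (real n * cyl_prob n)"
        using hits_power_dist_one[OF finite_atLeastAtMost \<theta>, of n 1 "2 * n" for n]
        by (intro always_eventually allI) (simp add: f_def mult.assoc)
      show "(\<lambda>n. 4 * (real n * cyl_prob n)) \<longlonglongrightarrow> 0"
        using tendsto_mult_left[OF n_cyl_prob_tendsto, of 4] by simp
    qed
    then show "(\<lambda>n. f n (2 * n)) \<longlonglongrightarrow> 1" by (simp add: LIM_zero_iff)
  qed
  ultimately have "(\<lambda>n. (f n (N n) - z n ^ (N n - 2 * n) * f n (2 * n)) + z n ^ (N n - 2 * n) * f n (2 * n))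
     \<longlonglongrightarrow> 0 + exp (- (a * of_real t)) * 1"
    by (rule tendsto_add)
  then show ?thesis by (simp add: f_def N_def a_def mult_ac)
qed

end

section \<open>Periodic and aperiodic points\<close>

lemma dvd_mult_iff_div_gcd_dvd:
  fixes p e s :: nat
  assumes "0 < p"
  shows "p div gcd p e dvd s \<longleftrightarrow> p dvd e * s"
proof -
  define g where "g = gcd p e"
  have g: "0 < g" using assms by (simp add: g_def)
  obtain p' e' where pe: "p = p' * g" "e = e' * g" "coprime p' e'"
    using gcd_coprime_exists[of p e] g unfolding g_def by (metis neq0_conv)
  have "p dvd e * s \<longleftrightarrow> g * p' dvd g * (e' * s)"
    by (simp add: pe(1,2) mult_ac)
  also have "\<dots> \<longleftrightarrow> p' dvd e' * s" using g by simp
  also have "\<dots> \<longleftrightarrow> p' dvd s" using pe(3) by (rule coprime_dvd_mult_right_iff)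
  finally show ?thesis unfolding g_def[symmetric] using g by (simp add: pe(1))
qed

text \<open>Moving the time by \<open>s\<close> moves the block in progression \<open>i\<close> by
  \<open>d i * s\<close>. Thus \<open>kappa\<close> generates the time shifts that are compatible
  with the period \<open>p\<close> in all progressions simultaneously.\<close>

lemma kappa_dvd_iff: "0 < p \<Longrightarrow> kappa l d p dvd s \<longleftrightarrow> (\<forall>i\<in>{1..l}. p dvd d i * s)"
  unfolding kappa_def by (simp add: Lcm_dvd_iff dvd_mult_iff_div_gcd_dvd)

text \<open>The shift \<open>p\<close> is itself compatible, so \<open>kappa\<close> divides
  \<open>p\<close> and cannot be 0.\<close>

lemma kappa_pos: "0 < p \<Longrightarrow> 0 < kappa l d p"
proof (rule ccontr)
  assume "0 < p" "\<not> 0 < kappa l d p"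
  then have "kappa l d p dvd p \<longleftrightarrow> False" by simp
  then show False using kappa_dvd_iff[OF \<open>0 < p\<close>, of l d p] by simp
qed

lemma periodic_add_mult:
  fixes \<alpha> :: "nat \<Rightarrow> 'a"
  assumes "\<And>i. \<alpha> (i + p) = \<alpha> i"
  shows "\<alpha> (i + p * e) = \<alpha> i"
proof (induction e)
  case (Suc e)
  then show ?case using assms[of "i + p * e"] by (simp add: algebra_simps)
qed simp

text \<open>Agreement on one period spreads by periodicity to all indices, so \<open>s mod p\<close>
  is a period of the entire sequence; being smaller than \<open>p\<close>, it must be 0.\<close>

lemma minimal_period_dvd:
  fixes \<alpha> :: "nat \<Rightarrow> 'a"
  assumes p: "0 < p" and per: "\<And>i. \<alpha> (i + p) = \<alpha> i"
    and least: "\<And>s. 1 \<le> s \<Longrightarrow> (\<And>i. \<alpha> (i + s) = \<alpha> i) \<Longrightarrow> p \<le> s"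
    and s: "\<And>x. x < p \<Longrightarrow> \<alpha> (x + s) = \<alpha> x"
  shows "p dvd s"
proof (rule ccontr)
  assume "\<not> p dvd s"
  then have 1: "1 \<le> s mod p" by (simp add: dvd_eq_mod_eq_0 Suc_leI)
  have add: "\<alpha> (x + p * e) = \<alpha> x" for x e
    using per by (rule periodic_add_mult)
  have "\<alpha> (i + s mod p) = \<alpha> i" for i
  proof -
    have "\<alpha> (i + s mod p) = \<alpha> (i + s mod p + p * (s div p))"
      by (rule add[symmetric])
    \<comment> \<open>Multiples of \<open>p\<close> are moved so that \<open>s\<close> acts on
      \<open>i mod p\<close>, the only range in which the hypothesis on \<open>s\<close> is
      available.\<close>
    also have "i + s mod p + p * (s div p) = i mod p + s + p * (i div p)"
      using mod_mult_div_eq[of s p] mod_mult_div_eq[of i p] by simp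
    also have "\<alpha> \<dots> = \<alpha> (i mod p + s)" by (rule add)
    also have "\<dots> = \<alpha> (i mod p)" using p by (intro s) simp
    also have "\<dots> = \<alpha> (i mod p + p * (i div p))" by (rule add[symmetric])
    finally show ?thesis by simp
  qed
  then have "p \<le> s mod p" using 1 by (intro least)
  then show False using mod_less_divisor[OF p, of s] by linarith
qed

text \<open>A window of length \<open>p\<close> may start anywhere: advancing it by one exchanges
  \<open>g n\<close> for the equal factor \<open>g (n + p)\<close>.\<close>

lemma prod_periodic:
  fixes g :: "nat \<Rightarrow> 'b::comm_monoid_mult"
  assumes per: "\<And>i. g (i + p) = g i"
  shows "(\<Prod>x\<in>{n..<n + p * e}. g x) = (\<Prod>x<p. g x) ^ e"
proof -
  have 1: "(\<Prod>x\<in>{n..<n + p}. g x) = (\<Prod>x<p. g x)" for n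
  proof (induction n)
    case 0
    then show ?case by (simp add: lessThan_atLeast0)
  next
    case (Suc n)
    show ?case
    proof (cases "p = 0")
      case False
      then have "(\<Prod>x\<in>{Suc n..<Suc n + p}. g x) = (\<Prod>x\<in>{Suc n..<n + p}. g x) * g (n + p)"
        by simp
      also have "\<dots> = (\<Prod>x\<in>{n..<n + p}. g x)"
        using False per[of n] by (simp add: prod.atLeast_Suc_lessThan mult.commute)
      finally show ?thesis using Suc by simp
    qed simp
  qed
  show ?thesis
  proof (induction e)
    case (Suc e)
    have "(\<Prod>x\<in>{n..<n + p * Suc e}. g x) =
        (\<Prod>x\<in>{n..<n + p * e}. g x) * (\<Prod>x\<in>{n + p * e..<(n + p * e) + p}. g x)"
      by (subst prod.atLeastLessThan_concat) (auto simp: algebra_simps)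
    then show ?case by (simp only: 1 Suc power_Suc2)
  qed simp
qed

text \<open>The indices with \<open>Y\<close> form an initial run, so this is the finite geometric
  sum. The gain is linearity in the indicators of the single \<open>Y j\<close>: expectations then
  need no joint law of the whole clump.\<close>

lemma power_sum_decreasing:
  fixes \<theta> :: complex
  assumes "\<And>j. 1 \<le> j \<Longrightarrow> Suc j \<le> J \<Longrightarrow> Y (Suc j) \<Longrightarrow> Y j"
  shows "\<theta> ^ (\<Sum>j=1..J. of_bool (Y j)) = 1 - (1 - \<theta>) * (\<Sum>j=1..J. \<theta> ^ (j - 1) * of_bool (Y j))"
  using assms
proof (induction J)
  case (Suc J)
  then have IH: "\<theta> ^ (\<Sum>j=1..J. of_bool (Y j)) = 1 - (1 - \<theta>) * (\<Sum>j=1..J. \<theta> ^ (j - 1) * of_bool (Y j))"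
    by simp
  show ?case
  proof (cases "Y (Suc J)")
    case True
    have "Y j" if "1 \<le> j" "j \<le> Suc J" for j
      using that(2,1) by (induction j rule: inc_induct) (use True Suc.prems in auto)
    then have all: "(\<Sum>j=1..Suc J. of_bool (Y j)) = Suc J" "(\<Sum>j=1..J. of_bool (Y j)) = J" by simp_all
    define S where "S = (\<Sum>j=1..J. \<theta> ^ (j - 1) * of_bool (Y j))"
    have "\<theta> ^ Suc J = \<theta> ^ J - (1 - \<theta>) * \<theta> ^ J" by (simp add: algebra_simps)
    also have "\<dots> = (1 - (1 - \<theta>) * S) - (1 - \<theta>) * \<theta> ^ J"
      using IH unfolding all S_def by (rule arg_cong)
    also have "\<dots> = 1 - (1 - \<theta>) * (S + \<theta> ^ J)" by (simp add: algebra_simps)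
    finally show ?thesis using True unfolding all S_def by simp
  qed (use IH in simp)
qed simp

lemma geometric_tail_le:
  fixes c :: real
  assumes "0 < c" "c < 1" "finite I" "\<And>s. s \<in> I \<Longrightarrow> R \<le> s"
  shows "(\<Sum>s\<in>I. c ^ s) \<le> c ^ R / (1 - c)"
proof -
  have "(\<Sum>s\<in>I. c ^ s) = c ^ R * (\<Sum>s\<in>I. c ^ (s - R))"
    using assms(4) by (simp add: sum_distrib_left power_add[symmetric])
  also have "(\<Sum>s\<in>I. c ^ (s - R)) = (\<Sum>j\<in>(\<lambda>s. s - R) ` I. c ^ j)"
    using assms(4) by (subst sum.reindex) (auto intro!: inj_onI simp: o_def, metis le_add_diff_inverse2)
  also have "\<dots> \<le> (\<Sum>j. c ^ j)"
    using assms by (intro sum_le_suminf summable_geometric) auto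
  also have "\<dots> = 1 / (1 - c)" using assms by (subst suminf_geometric) auto
  finally show ?thesis using assms(1) by simp
qed

section \<open>Clumps at an aperiodic point\<close>

context multiple_hits
begin

text \<open>Blocks of different progressions start at least \<open>k\<close> apart, so
  \<open>n \<le> k\<close> makes them disjoint.\<close>

lemma prob_all_hit:
  assumes "n \<le> k" shows "prob {\<omega>. all_hit n k \<omega>} = cyl_prob n ^ l"
proof -
  have "prob {\<omega>. all_hit n k \<omega>} = (\<Prod>i\<in>{1..l}. \<Prod>j<n. letter_prob (\<alpha> j))"
    unfolding all_hit_def
  proof (rule prob_blocks)
    fix i i' assume a: "i \<in> {1..l}" "i' \<in> {1..l}" "i < i'"
    have "d i * k + n \<le> (d i + 1) * k" using assms by simp
    also have "\<dots> \<le> d i' * k" using a by (intro mult_le_mono1 d_less)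
    finally show "d i * k + n \<le> d i' * k" .
  qed simp
  then show ?thesis by (simp add: cyl_prob_def)
qed

lemma integral_of_bool_complex:
  "{\<omega>. P \<omega>} \<in> events \<Longrightarrow> (\<integral>\<omega>. (of_bool (P \<omega>) :: complex) \<partial>M) = of_real (prob {\<omega>. P \<omega>})"
proof -
  assume *: "{\<omega>. P \<omega>} \<in> events"
  have "(\<integral>\<omega>. (of_bool (P \<omega>) :: complex) \<partial>M) = (\<integral>\<omega>. of_real (of_bool (P \<omega>)) \<partial>M)"
    by (intro Bochner_Integration.integral_cong) auto
  also have "\<dots> = of_real (\<integral>\<omega>. of_bool (P \<omega>) \<partial>M)" by (rule integral_complex_of_real)
  finally show ?thesis using integral_of_bool[OF *] by simp
qed

lemma lag_le_self: "lag n \<le> n"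
  by (simp add: lag_def)

lemma mult_lag_le: "i \<in> {1..l} \<Longrightarrow> s \<le> lag n \<Longrightarrow> d i * s \<le> n div 2"
  using lag_le[of n] d_le_last[of i] by (meson le_trans mult_le_mono)

text \<open>Two hits at distance \<open>s\<close> force the word to overlap itself with shift
  \<open>d l * s\<close>, which is impossible below \<open>r\<close>. The remaining distances are at
  least \<open>r div d l\<close> and contribute a geometric tail.\<close>

lemma near_aperiodic:
  assumes \<theta>: "norm (\<theta>::complex) = 1" and n: "1 \<le> n" and k: "2 * n \<le> k"
    and R: "\<And>s. 1 \<le> s \<Longrightarrow> s < r \<Longrightarrow> s < n \<Longrightarrow> \<exists>i. i + s < n \<and> \<alpha> (i + s) \<noteq> \<alpha> i"
  shows "norm ((\<integral>\<omega>. of_bool (all_hit n k \<omega>) * \<theta> ^ hits n {k - lag n..<k} \<omega> \<partial>M) - of_real (cyl_prob n ^ l) * 1)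
    \<le> cyl_prob n ^ l * (2 * (c ^ (r div d l) / (1 - c)))"
proof -
  let ?I = "{k - lag n..<k}"
  note lag_n = lag_le_self[of n]
  have q: "0 \<le> cyl_prob n ^ l" using cyl_prob_pos[of n] by simp
  have "norm ((\<integral>\<omega>. of_bool (all_hit n k \<omega>) * \<theta> ^ hits n ?I \<omega> \<partial>M) - (\<integral>\<omega>. of_bool (all_hit n k \<omega>) \<partial>M))
    \<le> (\<integral>\<omega>. 2 * (of_bool (all_hit n k \<omega>) * real (hits n ?I \<omega>)) \<partial>M)"
  proof (rule integral_dist_le)
    fix \<omega>
    show "norm (of_bool (all_hit n k \<omega>) * \<theta> ^ hits n ?I \<omega> - of_bool (all_hit n k \<omega>)) \<le>
      2 * (of_bool (all_hit n k \<omega>) * real (hits n ?I \<omega>))"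
      using norm_power_minus_one_le[OF \<theta>] by simp
    show "integrable M (\<lambda>\<omega>. of_bool (all_hit n k \<omega>) :: complex)"
      by (rule integrable_const_bound[where B = 1]) auto
  qed (use integrable_hits(2)[of ?I] in \<open>auto simp: integrable_hit_hits_power \<theta>\<close>)
  also have "\<dots> = 2 * (\<Sum>m\<in>?I. prob {\<omega>. all_hit n k \<omega> \<and> all_hit n m \<omega>})"
    by (simp add: integral_hits_pair)
  also have "(\<Sum>m\<in>?I. prob {\<omega>. all_hit n k \<omega> \<and> all_hit n m \<omega>}) \<le>
     (\<Sum>m\<in>?I. if r div d l \<le> k - m then cyl_prob n ^ l * c ^ (k - m) else 0)"
  proof (rule sum_mono)
    fix m assume m: "m \<in> ?I"
    then have s: "k - m \<le> lag n" "1 \<le> k - m" "m < k" by auto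
    show "prob {\<omega>. all_hit n k \<omega> \<and> all_hit n m \<omega>} \<le>
      (if r div d l \<le> k - m then cyl_prob n ^ l * c ^ (k - m) else 0)"
    proof (cases "r div d l \<le> k - m")
      case True
      have "min n (k - m) = k - m" using s lag_n by simp
      then show ?thesis using prob_pair_le[of n k m] s(3) k True by simp
    next
      case False
      \<comment> \<open>From here \<open>s\<close> is the shift of the block in the last
        progression, not the distance in time; the lag keeps it below \<open>n\<close>, so that the
        mismatch lies inside both blocks.\<close>
      define s where "s = d l * (k - m)"
      have sl: "s \<le> n div 2" unfolding s_def using s l by (intro mult_lag_le) auto
      have "k - m + 1 \<le> r div d l" using False by simp
      then have "d l * (k - m + 1) \<le> r"
        using d_last_pos by (simp add: less_eq_div_iff_mult_less_eq mult.commute)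
      then have "s < r" unfolding s_def using d_last_pos by simp
      moreover have "1 \<le> s" using s(2) d_last_pos by (simp add: s_def)
      moreover have "s < n" using sl n by linarith
      ultimately obtain i where i: "i + s < n" "\<alpha> (i + s) \<noteq> \<alpha> i" using R by blast
      have eq: "d l * k + i = d l * m + (i + s)"
      proof -
        have "d l * m + d l * (k - m) = d l * k"
          using s(3) by (metis add_mult_distrib2 le_add_diff_inverse less_imp_le)
        then show ?thesis by (simp add: s_def)
      qed
      have "\<not> (all_hit n k \<omega> \<and> all_hit n m \<omega>)" for \<omega>
      proof
        assume h: "all_hit n k \<omega> \<and> all_hit n m \<omega>"
        have "l \<in> {1..l}" using l by simp
        then have "\<omega> (d l * k + i) = \<alpha> i" "\<omega> (d l * m + (i + s)) = \<alpha> (i + s)"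
          using h i(1) unfolding all_hit_def by auto
        then show False using i(2) eq by metis
      qed
      then have empty: "{\<omega>. all_hit n k \<omega> \<and> all_hit n m \<omega>} = {}" by blast
      show ?thesis unfolding empty using False by simp
    qed
  qed
  also have "\<dots> = (\<Sum>s\<in>{1..lag n}. if r div d l \<le> s then cyl_prob n ^ l * c ^ s else 0)"
    by (rule sum.reindex_bij_witness[of _ "\<lambda>s. k - s" "\<lambda>m. k - m"]) (use k lag_n n in auto)
  also have "\<dots> = cyl_prob n ^ l * (\<Sum>s\<in>{s\<in>{1..lag n}. r div d l \<le> s}. c ^ s)"
    by (subst sum.inter_filter[symmetric]) (auto simp: sum_distrib_left)
  also have "\<dots> \<le> cyl_prob n ^ l * (c ^ (r div d l) / (1 - c))"
    using c_pos c_less q by (intro mult_left_mono geometric_tail_le) auto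
  finally show ?thesis using k by (simp add: integral_of_bool_complex all_hit_event prob_all_hit mult.left_commute)
qed

text \<open>The first summand is already positive. This gives \<open>\<rho> < 1\<close> at a
  periodic point and lets the clump parameter vanish at an aperiodic one.\<close>

lemma kappa_exponent_pos:
  assumes "0 < r" shows "0 < (\<Sum>i=1..l. d i * kappa l d r div r)"
proof -
  have "r dvd d 1 * kappa l d r"
    using kappa_dvd_iff[OF assms, of l d "kappa l d r"] l by simp
  moreover have "0 < d 1 * kappa l d r" using d_pos kappa_pos[OF assms, of l d] by simp
  ultimately have "0 < d 1 * kappa l d r div r"
    using assms by (simp add: div_greater_zero_iff dvd_imp_le)
  also have "\<dots> \<le> (\<Sum>i=1..l. d i * kappa l d r div r)"
    using l by (intro member_le_sum) auto
  finally show ?thesis .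
qed

lemma aperiodic_limit:
  assumes \<theta>: "norm (\<theta>::complex) = 1" and t: "t > 0"
    and r: "filterlim r at_top sequentially"
    and R: "\<And>n s. 1 \<le> s \<Longrightarrow> s < r n \<Longrightarrow> s < n \<Longrightarrow> \<exists>i. i + s < n \<and> \<alpha> (i + s) \<noteq> \<alpha> i"
  shows "(\<lambda>n. \<integral>\<omega>. \<theta> ^ hits n {1..obs_time t n} \<omega> \<partial>M) \<longlonglongrightarrow> exp (of_real t * (\<theta> - 1))"
proof -
  have "(\<lambda>n. \<integral>\<omega>. \<theta> ^ hits n {1..obs_time t n} \<omega> \<partial>M) \<longlonglongrightarrow> exp (- (of_real t * (1 - \<theta>) * 1))"
  proof (rule hits_power_limit[OF \<theta> _ t])
    show "0 \<le> Re ((1 - \<theta>) * 1)" using complex_Re_le_cmod[of \<theta>] \<theta> by simp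
    have "filterlim (\<lambda>n. n div d l) sequentially sequentially"
      using d_last_pos by (rule filterlim_div_sequentially)
    from filterlim_compose[OF this r] have "filterlim (\<lambda>n. r n div d l) sequentially sequentially" .
    moreover have "(\<lambda>n. 2 * (c ^ n / (1 - c))) \<longlonglongrightarrow> 2 * (0 / (1 - c))"
      using c_pos c_less by (intro tendsto_intros LIMSEQ_power_zero) auto
    ultimately show "(\<lambda>n. 2 * (c ^ (r n div d l) / (1 - c))) \<longlonglongrightarrow> 0"
      using filterlim_compose by fastforce
    show "\<forall>\<^sub>F n in sequentially. \<forall>k\<ge>2 * n.
      norm ((\<integral>\<omega>. of_bool (all_hit n k \<omega>) * \<theta> ^ hits n {k - lag n..<k} \<omega> \<partial>M) - of_real (cyl_prob n ^ l) * 1)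
        \<le> cyl_prob n ^ l * (2 * (c ^ (r n div d l) / (1 - c)))"
      using eventually_ge_at_top[of 1]
      by eventually_elim (use near_aperiodic[OF \<theta> _ _ R] in blast)
  qed
  then show ?thesis by (simp add: algebra_simps)
qed

end

section \<open>Clumps at a periodic point\<close>

locale periodic_multiple_hits = multiple_hits +
  fixes p :: nat
  assumes p: "0 < p" and per: "\<alpha> (i + p) = \<alpha> i"
    and least: "1 \<le> s \<Longrightarrow> (\<And>i. \<alpha> (i + s) = \<alpha> i) \<Longrightarrow> p \<le> s"
begin

definition \<kappa> :: nat where "\<kappa> = kappa l d p"

text \<open>Going back by one more \<open>\<kappa>\<close> lengthens the block in progression
  \<open>i\<close> by \<open>d i * \<kappa>\<close> letters, that is by
  \<open>d i * \<kappa> div p\<close> complete periods, each of probability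
  \<open>cyl_prob p\<close>.\<close>

definition \<rho> :: real where "\<rho> = cyl_prob p ^ (\<Sum>i=1..l. d i * \<kappa> div p)"

lemma \<kappa>_pos: "0 < \<kappa>"
  unfolding \<kappa>_def by (rule kappa_pos[OF p])

lemma p_dvd: "i \<in> {1..l} \<Longrightarrow> p dvd d i * \<kappa>"
  using kappa_dvd_iff[OF p, of l d "kappa l d p"] by (simp add: \<kappa>_def)

lemma \<alpha>_add: "i \<in> {1..l} \<Longrightarrow> \<alpha> (x + d i * (j * \<kappa>)) = \<alpha> x"
proof -
  assume "i \<in> {1..l}"
  from p_dvd[OF this] obtain e where "d i * \<kappa> = p * e" by (rule dvdE)
  then have "d i * (j * \<kappa>) = p * (e * j)" by (metis mult.assoc mult.commute)
  show ?thesis unfolding \<open>d i * (j * \<kappa>) = _\<close> by (rule periodic_add_mult) (rule per)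
qed

text \<open>In each progression the two overlapping blocks merge into one longer periodic block.\<close>

lemma joint_hit_iff:
  assumes "j * \<kappa> \<le> lag n" "2 * n \<le> k"
  shows "all_hit n k \<omega> \<and> all_hit n (k - j * \<kappa>) \<omega> \<longleftrightarrow>
     (\<forall>i\<in>{1..l}. \<forall>x<n + d i * (j * \<kappa>). \<omega> (d i * (k - j * \<kappa>) + x) = \<alpha> x)" (is "?l \<longleftrightarrow> ?r")
proof
  have jk: "j * \<kappa> \<le> k" using assms lag_le_self[of n] by linarith
  have dk: "d i * k = d i * (k - j * \<kappa>) + d i * (j * \<kappa>)" for i
    using jk by (metis add_mult_distrib2 le_add_diff_inverse2)
  show ?r if h: ?l
  proof (intro ballI allI impI)
    fix i x assume i: "i \<in> {1..l}" and x: "x < n + d i * (j * \<kappa>)"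
    show "\<omega> (d i * (k - j * \<kappa>) + x) = \<alpha> x"
    proof (cases "x < n")
      case True
      then show ?thesis using h i by (auto simp: all_hit_def)
    next
      case False
      \<comment> \<open>A letter beyond the first \<open>n\<close> belongs to the block of
        \<open>k\<close>. The shift between the blocks is a multiple of \<open>p\<close>, so that
        block prescribes the same letter.\<close>
      have "d i * (j * \<kappa>) \<le> n div 2" using mult_lag_le[OF i assms(1)] .
      then have le: "d i * (j * \<kappa>) \<le> x" using False by linarith
      have "\<omega> (d i * k + (x - d i * (j * \<kappa>))) = \<alpha> (x - d i * (j * \<kappa>))"
        using h i x le less_diff_conv2[OF le, of n] unfolding all_hit_def by blast
      also have "\<dots> = \<alpha> x" using \<alpha>_add[OF i, of "x - d i * (j * \<kappa>)" j] le by simp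
      finally show ?thesis using le dk[of i] by simp
    qed
  qed
  show ?l if h: ?r
    unfolding all_hit_def
  proof (intro conjI ballI allI impI)
    fix i x assume i: "i \<in> {1..l}" and x: "x < n"
    show "\<omega> (d i * (k - j * \<kappa>) + x) = \<alpha> x" using h i x by auto
    have "\<omega> (d i * (k - j * \<kappa>) + (x + d i * (j * \<kappa>))) = \<alpha> (x + d i * (j * \<kappa>))" using h i x by auto
    then show "\<omega> (d i * k + x) = \<alpha> x" using \<alpha>_add[OF i, of x j] dk[of i] by (simp add: algebra_simps)
  qed
qed

text \<open>The merged blocks of the two outer times contain all blocks of the intermediate time and
  show the right letters there. Hence a clump has no gaps, as \<open>power_sum_decreasing\<close>
  requires.\<close>

lemma joint_hit_antimono:
  assumes "Suc j * \<kappa> \<le> lag n" "2 * n \<le> k" "all_hit n k \<omega>" "all_hit n (k - Suc j * \<kappa>) \<omega>"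
  shows "all_hit n (k - j * \<kappa>) \<omega>"
  unfolding all_hit_def
proof (intro ballI allI impI)
  fix i x assume i: "i \<in> {1..l}" and x: "x < n"
  have jk: "Suc j * \<kappa> \<le> k" using assms(1,2) lag_le_self[of n] by linarith
  then have "k - j * \<kappa> = (k - Suc j * \<kappa>) + \<kappa>" by simp
  then have eq: "d i * (k - j * \<kappa>) + x = d i * (k - Suc j * \<kappa>) + (x + d i * (1 * \<kappa>))"
    by (simp only: add_mult_distrib2 mult_1 add.assoc add.commute)
  have "x + d i * (1 * \<kappa>) < n + d i * (Suc j * \<kappa>)" using x by (simp add: algebra_simps add_less_le_mono)
  then have "\<omega> (d i * (k - Suc j * \<kappa>) + (x + d i * (1 * \<kappa>))) = \<alpha> (x + d i * (1 * \<kappa>))"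
    using joint_hit_iff[OF assms(1,2), of \<omega>] assms(3,4) i by blast
  then show "\<omega> (d i * (k - j * \<kappa>) + x) = \<alpha> x" using eq \<alpha>_add[OF i, of x 1] by metis
qed

lemma prob_joint_hit:
  assumes "j * \<kappa> \<le> lag n" "2 * n \<le> k"
  shows "prob {\<omega>. all_hit n k \<omega> \<and> all_hit n (k - j * \<kappa>) \<omega>} = cyl_prob n ^ l * \<rho> ^ j"
proof -
  have "prob {\<omega>. all_hit n k \<omega> \<and> all_hit n (k - j * \<kappa>) \<omega>} =
     (\<Prod>i\<in>{1..l}. \<Prod>x<n + d i * (j * \<kappa>). letter_prob (\<alpha> x))"
    unfolding joint_hit_iff[OF assms]
  proof (rule prob_blocks)
    fix i i' assume a: "i \<in> {1..l}" "i' \<in> {1..l}" "i < i'"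
    have jk: "j * \<kappa> \<le> k" using assms lag_le_self[of n] by linarith
    have dk: "d i * k = d i * (k - j * \<kappa>) + d i * (j * \<kappa>)" for i
      using jk by (metis add_mult_distrib2 le_add_diff_inverse2)
    \<comment> \<open>Merging moves the start of a block left by at most \<open>n div 2\<close>,
      while the unmerged starts are at least \<open>k\<close>, hence \<open>2 * n\<close>, apart;
      the merged blocks therefore remain disjoint.\<close>
    have "d i * k + k \<le> d i' * k" using mult_le_mono1[OF d_less[OF a], of k] by simp
    moreover have "d i' * (j * \<kappa>) \<le> n div 2" using mult_lag_le[OF a(2) assms(1)] .
    ultimately show "d i * (k - j * \<kappa>) + (n + d i * (j * \<kappa>)) \<le> d i' * (k - j * \<kappa>)"
      using dk[of i] dk[of i'] assms(2) by linarith
  qed simp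
  also have "\<dots> = (\<Prod>i\<in>{1..l}. cyl_prob n * (cyl_prob p ^ (d i * \<kappa> div p)) ^ j)"
  proof (rule prod.cong[OF refl])
    fix i assume i: "i \<in> {1..l}"
    from p_dvd[OF i] obtain e where e: "d i * \<kappa> = p * e" by (rule dvdE)
    then have e': "d i * (j * \<kappa>) = p * (e * j)" by (metis mult.assoc mult.commute)
    have "(\<Prod>x<n + d i * (j * \<kappa>). letter_prob (\<alpha> x)) =
      (\<Prod>x<n. letter_prob (\<alpha> x)) * (\<Prod>x\<in>{n..<n + p * (e * j)}. letter_prob (\<alpha> x))"
      unfolding e' lessThan_atLeast0 by (rule prod.atLeastLessThan_concat[symmetric]) auto
    also have "(\<Prod>x\<in>{n..<n + p * (e * j)}. letter_prob (\<alpha> x)) = cyl_prob p ^ (e * j)"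
      unfolding cyl_prob_def by (rule prod_periodic) (simp add: per)
    finally show "(\<Prod>x<n + d i * (j * \<kappa>). letter_prob (\<alpha> x)) = cyl_prob n * (cyl_prob p ^ (d i * \<kappa> div p)) ^ j"
      using e p by (simp add: cyl_prob_def power_mult)
  qed
  also have "\<dots> = cyl_prob n ^ l * \<rho> ^ j"
    by (simp add: prod.distrib \<rho>_def power_sum prod_power_distrib)
  finally show ?thesis .
qed

text \<open>Within the lag, the two blocks in each progression share at least \<open>n / 2\<close>
  letters, hence a full period when \<open>2 * p \<le> n\<close>. By minimality of \<open>p\<close>
  every shift \<open>d i * s\<close> is then a multiple of \<open>p\<close>.\<close>

lemma near_hit_multiple:
  assumes n: "2 * p \<le> n" and s: "s \<le> lag n" "s \<le> k" and h: "all_hit n k \<omega>" "all_hit n (k - s) \<omega>"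
  shows "\<kappa> dvd s"
  unfolding \<kappa>_def kappa_dvd_iff[OF p]
proof
  fix i assume i: "i \<in> {1..l}"
  have le: "d i * s \<le> n div 2" using mult_lag_le[OF i s(1)] .
  show "p dvd d i * s"
  proof (rule minimal_period_dvd[where \<alpha> = \<alpha>, OF p])
    fix x assume "x < p"
    then have x: "x + d i * s < n" "x < n" using le n by linarith+
    have "d i * k + x = d i * (k - s) + (x + d i * s)"
      using s(2) by (metis add.assoc add.commute add_mult_distrib2 le_add_diff_inverse2)
    then show "\<alpha> (x + d i * s) = \<alpha> x" using h i x unfolding all_hit_def by metis
  qed (auto simp: per intro: least)
qed

text \<open>Given a hit at \<open>k\<close>, only distances divisible by \<open>\<kappa>\<close>
  survive, which leaves a count indexed by the steps of the run.\<close>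

lemma hits_near:
  assumes n: "2 * p \<le> n" and k: "2 * n \<le> k" and h: "all_hit n k \<omega>"
  shows "hits n {k - lag n..<k} \<omega> = (\<Sum>j=1..lag n div \<kappa>. of_bool (all_hit n (k - j * \<kappa>) \<omega>))"
proof -
  have lk: "lag n < k" using k n p unfolding lag_def by (metis div_le_dividend le_less_trans less_le_trans mult_2 less_add_same_cancel1 mult_pos_pos zero_less_numeral)
  have le: "j * \<kappa> \<le> lag n" if "j \<le> lag n div \<kappa>" for j
    using that \<kappa>_pos by (simp add: less_eq_div_iff_mult_less_eq)
  have inj: "inj_on (\<lambda>j. k - j * \<kappa>) {1..lag n div \<kappa>}"
  proof (rule inj_onI)
    fix i j assume "i \<in> {1..lag n div \<kappa>}" "j \<in> {1..lag n div \<kappa>}" "k - i * \<kappa> = k - j * \<kappa>"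
    moreover from this have "i * \<kappa> \<le> k" "j * \<kappa> \<le> k" using le lk by fastforce+
    ultimately have "i * \<kappa> = j * \<kappa>" by linarith
    then show "i = j" using \<kappa>_pos by simp
  qed
  have "hits n {k - lag n..<k} \<omega> = (\<Sum>m\<in>(\<lambda>j. k - j * \<kappa>) ` {1..lag n div \<kappa>}. of_bool (all_hit n m \<omega>))"
    unfolding hits_def
  proof (rule sum.mono_neutral_right)
    show "(\<lambda>j. k - j * \<kappa>) ` {1..lag n div \<kappa>} \<subseteq> {k - lag n..<k}"
      using le lk \<kappa>_pos by (auto intro!: diff_le_mono2)
    show "\<forall>m\<in>{k - lag n..<k} - (\<lambda>j. k - j * \<kappa>) ` {1..lag n div \<kappa>}. of_bool (all_hit n m \<omega>) = (0::nat)"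
    proof
      fix m assume m: "m \<in> {k - lag n..<k} - (\<lambda>j. k - j * \<kappa>) ` {1..lag n div \<kappa>}"
      have "\<not> all_hit n m \<omega>"
      proof
        assume "all_hit n m \<omega>"
        then have "\<kappa> dvd k - m"
          using m by (intro near_hit_multiple[OF n _ _ h]) auto
        then obtain j where j: "k - m = \<kappa> * j" by (rule dvdE)
        then have "j \<noteq> 0" using m by (intro notI) simp
        moreover have "j \<le> lag n div \<kappa>"
        proof -
          have "k - lag n \<le> m" using m by simp
          then have "j * \<kappa> \<le> lag n" using j by (simp add: mult.commute)
          then show ?thesis using \<kappa>_pos by (simp add: less_eq_div_iff_mult_less_eq)
        qed
        moreover have "m < k" using m by simp
        then have "m = k - j * \<kappa>" using j by (metis diff_diff_cancel less_imp_le mult.commute)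
        ultimately show False using m by force
      qed
      then show "of_bool (all_hit n m \<omega>) = (0::nat)" by simp
    qed
  qed simp
  also have "\<dots> = (\<Sum>j=1..lag n div \<kappa>. of_bool (all_hit n (k - j * \<kappa>) \<omega>))"
    by (simp only: sum.reindex[OF inj] o_def)
  finally show ?thesis .
qed

text \<open>An exact identity: the sum is the truncation at the lag of the series whose limit gives
  \<open>\<gamma>\<close>, and the pair probabilities are the only probabilistic input.\<close>

lemma near_periodic:
  fixes \<theta> :: complex
  assumes n: "2 * p \<le> n" and k: "2 * n \<le> k"
  shows "(\<integral>\<omega>. of_bool (all_hit n k \<omega>) * \<theta> ^ hits n {k - lag n..<k} \<omega> \<partial>M) =
    of_real (cyl_prob n ^ l) * (1 - (1 - \<theta>) * (\<Sum>j=1..lag n div \<kappa>. \<theta> ^ (j - 1) * of_real \<rho> ^ j))"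
proof -
  let ?J = "lag n div \<kappa>"
  define Z where "Z j \<omega> = (of_bool (all_hit n k \<omega> \<and> all_hit n (k - j * \<kappa>) \<omega>) :: complex)" for j \<omega>
  have le: "j * \<kappa> \<le> lag n" if "j \<le> ?J" for j
    using that \<kappa>_pos by (simp add: less_eq_div_iff_mult_less_eq)
  have "of_bool (all_hit n k \<omega>) * \<theta> ^ hits n {k - lag n..<k} \<omega> =
     of_bool (all_hit n k \<omega>) - (1 - \<theta>) * (\<Sum>j=1..?J. \<theta> ^ (j - 1) * Z j \<omega>)" for \<omega>
  proof (cases "all_hit n k \<omega>")
    case True
    have "\<theta> ^ hits n {k - lag n..<k} \<omega> =
      1 - (1 - \<theta>) * (\<Sum>j=1..?J. \<theta> ^ (j - 1) * of_bool (all_hit n (k - j * \<kappa>) \<omega>))"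
      unfolding hits_near[OF n k True]
      by (rule power_sum_decreasing) (use joint_hit_antimono[OF le k True] in blast)
    with True show ?thesis by (simp add: Z_def)
  qed (simp add: Z_def)
  moreover have int: "integrable M (Z j)" for j
    unfolding Z_def of_bool_conj by (rule integrable_const_bound[where B = 1]) auto
  moreover have int1: "integrable M (\<lambda>\<omega>. of_bool (all_hit n k \<omega>) :: complex)"
    by (rule integrable_const_bound[where B = 1]) auto
  ultimately have "(\<integral>\<omega>. of_bool (all_hit n k \<omega>) * \<theta> ^ hits n {k - lag n..<k} \<omega> \<partial>M) =
     (\<integral>\<omega>. of_bool (all_hit n k \<omega>) \<partial>M) - (1 - \<theta>) * (\<Sum>j=1..?J. \<theta> ^ (j - 1) * (\<integral>\<omega>. Z j \<omega> \<partial>M))"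
    by simp
  also have "(\<integral>\<omega>. of_bool (all_hit n k \<omega>) \<partial>M) = complex_of_real (cyl_prob n ^ l)"
    using k by (simp add: integral_of_bool_complex all_hit_event prob_all_hit)
  also have "(\<Sum>j=1..?J. \<theta> ^ (j - 1) * (\<integral>\<omega>. Z j \<omega> \<partial>M)) =
     (\<Sum>j=1..?J. \<theta> ^ (j - 1) * of_real (cyl_prob n ^ l * \<rho> ^ j))"
    using prob_joint_hit[OF le k] unfolding Z_def
    by (intro sum.cong refl) (simp add: integral_of_bool_complex all_hit_pair_event)
  finally show ?thesis by (simp add: sum_distrib_left right_diff_distrib mult_ac)
qed

lemma rho_bounds: "0 < \<rho>" "\<rho> < 1"
proof -
  show "0 < \<rho>" unfolding \<rho>_def using cyl_prob_pos by simp
  have "cyl_prob p < 1"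
    using cyl_prob_le[of p] c_pos c_less p by (meson le_less_trans power_Suc_less_one less_imp_le power_less_one_iff)
  moreover have "0 < (\<Sum>i=1..l. d i * \<kappa> div p)"
    unfolding \<kappa>_def by (rule kappa_exponent_pos[OF p])
  ultimately show "\<rho> < 1"
    unfolding \<rho>_def using cyl_prob_pos[of p] by (simp add: power_less_one_iff less_imp_le)
qed

lemma periodic_limit:
  assumes \<theta>: "norm (\<theta>::complex) = 1" and t: "t > 0"
  shows "(\<lambda>n. \<integral>\<omega>. \<theta> ^ hits n {1..obs_time t n} \<omega> \<partial>M) \<longlonglongrightarrow>
     exp (of_real (t * (1 - \<rho>)) * ((1 - of_real \<rho>) * \<theta> / (1 - of_real \<rho> * \<theta>) - 1))"
proof -
  define \<gamma> where "\<gamma> = (1 - of_real \<rho>) / (1 - of_real \<rho> * \<theta>)"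
  have n\<rho>\<theta>: "norm (of_real \<rho> * \<theta>) < 1" using \<theta> rho_bounds by (simp add: norm_mult)
  then have ne: "1 - of_real \<rho> * \<theta> \<noteq> 0" by auto
  \<comment> \<open>The fraction on the right is the generating function of the geometric law on
    \<open>{1, 2, ...}\<close>. This form shows that the real part is nonnegative and matches the
    exponent of the compound Poisson law of intensity \<open>t * (1 - \<rho>)\<close>.\<close>
  have expand: "(1 - \<theta>) * \<gamma> = (1 - of_real \<rho>) * (1 - (1 - of_real \<rho>) * \<theta> / (1 - of_real \<rho> * \<theta>))"
    using ne unfolding \<gamma>_def by (simp add: field_simps)
  have "(\<lambda>n. \<integral>\<omega>. \<theta> ^ hits n {1..obs_time t n} \<omega> \<partial>M) \<longlonglongrightarrow> exp (- (of_real t * (1 - \<theta>) * \<gamma>))"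
  proof (rule hits_power_limit[OF \<theta> _ t])
    have "norm ((1 - of_real \<rho>) * \<theta> / (1 - of_real \<rho> * \<theta>)) \<le> 1"
    proof -
      have "1 - \<rho> \<le> norm (1 - of_real \<rho> * \<theta>)"
        using norm_triangle_ineq2[of 1 "of_real \<rho> * \<theta>"] \<theta> rho_bounds by (simp add: norm_mult)
      moreover have "norm (1 - complex_of_real \<rho>) = 1 - \<rho>"
        using rho_bounds by (metis abs_of_pos diff_gt_0_iff_gt norm_of_real of_real_1 of_real_diff)
      ultimately show ?thesis using ne \<theta> by (simp add: norm_divide norm_mult)
    qed
    then have "Re ((1 - of_real \<rho>) * \<theta> / (1 - of_real \<rho> * \<theta>)) \<le> 1"
      using complex_Re_le_cmod order_trans by blast
    moreover have "Re ((1 - complex_of_real \<rho>) * w) = (1 - \<rho>) * Re w" for w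
      by (simp add: algebra_simps)
    ultimately show "0 \<le> Re ((1 - \<theta>) * \<gamma>)"
      unfolding expand using rho_bounds by simp
    \<comment> \<open>The error of truncating the geometric series after \<open>J\<close> terms; it
      does not depend on \<open>k\<close> and depends on \<open>n\<close> only through
      \<open>J\<close>.\<close>
    define e where "e J = norm (1 - (1 - \<theta>) * (\<Sum>j=1..J. \<theta> ^ (j - 1) * of_real \<rho> ^ j) - \<gamma>)" for J
    have "(\<lambda>j. of_real \<rho> * (of_real \<rho> * \<theta>) ^ j) sums (of_real \<rho> * (1 / (1 - of_real \<rho> * \<theta>)))"
      using n\<rho>\<theta> by (intro sums_mult geometric_sums)
    then have "(\<lambda>J. \<Sum>j<J. of_real \<rho> * (of_real \<rho> * \<theta>) ^ j) \<longlonglongrightarrow> of_real \<rho> * (1 / (1 - of_real \<rho> * \<theta>))"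
      by (simp add: sums_def)
    moreover have "(\<Sum>j<J. of_real \<rho> * (of_real \<rho> * \<theta>) ^ j) = (\<Sum>j=1..J. \<theta> ^ (j - 1) * of_real \<rho> ^ j)" for J
      by (rule sum.reindex_bij_witness[of _ "\<lambda>j. j - 1" Suc]) (auto simp: power_mult_distrib)
    ultimately have "(\<lambda>J. \<Sum>j=1..J. \<theta> ^ (j - 1) * of_real \<rho> ^ j) \<longlonglongrightarrow> of_real \<rho> * (1 / (1 - of_real \<rho> * \<theta>))"
      by simp
    then have "e \<longlonglongrightarrow> norm (1 - (1 - \<theta>) * (of_real \<rho> * (1 / (1 - of_real \<rho> * \<theta>))) - \<gamma>)"
      unfolding e_def by (intro tendsto_intros)
    also have "1 - (1 - \<theta>) * (of_real \<rho> * (1 / (1 - of_real \<rho> * \<theta>))) - \<gamma> = 0"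
      using ne unfolding \<gamma>_def by (simp add: field_simps)
    finally have e_lim: "e \<longlonglongrightarrow> 0" by simp
    have "filterlim (\<lambda>n. lag n div \<kappa>) sequentially sequentially"
      unfolding lag_def div_mult2_eq[symmetric]
      using d_last_pos \<kappa>_pos by (intro filterlim_div_sequentially) simp
    from filterlim_compose[OF e_lim this] show "(\<lambda>n. e (lag n div \<kappa>)) \<longlonglongrightarrow> 0" .
    show "\<forall>\<^sub>F n in sequentially. \<forall>k\<ge>2 * n.
      norm ((\<integral>\<omega>. of_bool (all_hit n k \<omega>) * \<theta> ^ hits n {k - lag n..<k} \<omega> \<partial>M) - of_real (cyl_prob n ^ l) * \<gamma>)
        \<le> cyl_prob n ^ l * e (lag n div \<kappa>)"
      using eventually_ge_at_top[of "2 * p"]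
    proof eventually_elim
      case (elim n)
      show ?case
      proof (intro allI impI)
        fix k assume "2 * n \<le> k"
        show "norm ((\<integral>\<omega>. of_bool (all_hit n k \<omega>) * \<theta> ^ hits n {k - lag n..<k} \<omega> \<partial>M) - of_real (cyl_prob n ^ l) * \<gamma>)
          \<le> cyl_prob n ^ l * e (lag n div \<kappa>)"
          unfolding near_periodic[OF elim \<open>2 * n \<le> k\<close>] e_def right_diff_distrib[symmetric] norm_mult
            norm_of_real
          using cyl_prob_pos[of n] by simp
      qed
    qed
  qed
  moreover have "- (of_real t * (1 - \<theta>) * \<gamma>) =
     of_real (t * (1 - \<rho>)) * ((1 - of_real \<rho>) * \<theta> / (1 - of_real \<rho> * \<theta>) - 1)"
  proof -
    have "- (T * ((1 - r) * (1 - w))) = T * ((1 - r) * (w - 1))" for T r w :: complex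
      by (simp add: algebra_simps)
    then show ?thesis by (simp only: expand mult.assoc of_real_mult of_real_diff of_real_1)
  qed
  ultimately show ?thesis by simp
qed

end

section \<open>Compound Poisson distributions\<close>

text \<open>Conditioning on the value of \<open>W\<close> without conditional expectations: on each
  event of the partition a sum of \<open>W\<close> terms has a fixed length. Interchange of sum and
  integral is dominated, since the norms add up to at most 1.\<close>

lemma (in prob_space) expectation_partition_sums:
  fixes F :: "'a \<Rightarrow> complex"
  assumes W: "W \<in> M \<rightarrow>\<^sub>M count_space (UNIV :: nat set)"
    and F: "F \<in> borel_measurable M" "\<And>x. norm (F x) \<le> 1"
  shows "(\<lambda>m. \<integral>x. of_bool (W x = m) * F x \<partial>M) sums (\<integral>x. F x \<partial>M)"
proof -
  let ?f = "\<lambda>m x. of_bool (W x = m) * F x"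
  have ev [measurable]: "Measurable.pred M (\<lambda>x. W x = m)" for m
    using W by measurable
  have [measurable]: "F \<in> borel_measurable M" by fact
  have int: "integrable M (?f m)" for m
    by (rule integrable_const_bound[where B = 1]) (auto simp: F norm_mult)
  have single: "(\<lambda>m. ?f m x) sums F x" for x
  proof -
    have "(\<lambda>m. ?f m x) = (\<lambda>m. if m = W x then F x else 0)" by auto
    then show ?thesis using sums_single[of "W x" "\<lambda>_. F x"] by simp
  qed
  have "(\<lambda>m. integral\<^sup>L M (?f m)) sums (\<integral>x. (\<Sum>m. ?f m x) \<partial>M)"
  proof (rule sums_integral[OF int])
    show "AE x in M. summable (\<lambda>m. norm (?f m x))"
    proof (intro AE_I2)
      fix x show "summable (\<lambda>m. norm (?f m x))"
        by (rule summable_finite[of "{W x}"]) auto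
    qed
    show "summable (\<lambda>m. \<integral>x. norm (?f m x) \<partial>M)"
    proof (rule summableI_nonneg_bounded)
      fix n
      have "(\<Sum>m<n. \<integral>x. norm (?f m x) \<partial>M) = (\<integral>x. (\<Sum>m<n. norm (?f m x)) \<partial>M)"
        using int by (intro Bochner_Integration.integral_sum[symmetric] integrable_norm)
      also have "\<dots> \<le> (\<integral>x. 1 \<partial>M)"
      proof (rule integral_mono)
        show "integrable M (\<lambda>x. \<Sum>m<n. norm (?f m x))"
          using int by (intro Bochner_Integration.integrable_sum integrable_norm)
        fix x
        have "(\<Sum>m<n. norm (?f m x)) = (\<Sum>m\<in>{..<n}. if m = W x then norm (F x) else 0)"
          by (intro sum.cong) auto
        also have "\<dots> \<le> 1" using F(2)[of x] by (subst sum.delta) auto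
        finally show "(\<Sum>m<n. norm (?f m x)) \<le> 1" .
      qed simp
      finally show "(\<Sum>m<n. \<integral>x. norm (?f m x) \<partial>M) \<le> 1" using prob_space by simp
    qed simp
  qed
  then show ?thesis using sums_unique[OF single] by simp
qed

lemma (in prob_space) integral_of_bool_eq:
  assumes "W \<in> M \<rightarrow>\<^sub>M count_space (UNIV :: nat set)"
  shows "(\<integral>x. of_bool (W x = m) \<partial>M) = complex_of_real (prob {x \<in> space M. W x = m})"
proof -
  have [measurable]: "W \<in> M \<rightarrow>\<^sub>M count_space UNIV" by fact
  have E: "{x \<in> space M. W x = m} \<in> events" by measurable
  have "(\<integral>x. of_bool (W x = m) \<partial>M) = (\<integral>x. complex_of_real (indicator {x \<in> space M. W x = m} x) \<partial>M)"
    by (intro Bochner_Integration.integral_cong) (auto simp: indicator_def)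
  also have "\<dots> = of_real (\<integral>x. indicator {x \<in> space M. W x = m} x \<partial>M)"
    by (rule integral_complex_of_real)
  finally show ?thesis using E by simp
qed

lemma (in prob_space) power_expectation_sums:
  fixes \<theta> :: complex
  assumes W: "W \<in> M \<rightarrow>\<^sub>M count_space (UNIV :: nat set)" and \<theta>: "norm \<theta> = 1"
  shows "(\<lambda>m. of_real (prob {x \<in> space M. W x = m}) * \<theta> ^ m) sums (\<integral>x. \<theta> ^ W x \<partial>M)"
proof -
  have [measurable]: "W \<in> M \<rightarrow>\<^sub>M count_space UNIV" by fact
  have "(\<lambda>m. \<integral>x. of_bool (W x = m) * \<theta> ^ W x \<partial>M) sums (\<integral>x. \<theta> ^ W x \<partial>M)"
    using W by (rule expectation_partition_sums) (auto simp: norm_power \<theta>)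
  moreover have "(\<integral>x. of_bool (W x = m) * \<theta> ^ W x \<partial>M) = of_real (prob {x \<in> space M. W x = m}) * \<theta> ^ m" for m
  proof -
    have "(\<integral>x. of_bool (W x = m) * \<theta> ^ W x \<partial>M) = (\<integral>x. of_bool (W x = m) * \<theta> ^ m \<partial>M)"
      by (intro Bochner_Integration.integral_cong) auto
    then show ?thesis by (simp add: integral_of_bool_eq[OF W])
  qed
  ultimately show ?thesis by simp
qed

lemma poisson_power_sums:
  fixes z :: complex
  shows "(\<lambda>m. of_real (s ^ m / fact m * exp (- s)) * z ^ m) sums exp (of_real s * (z - 1))"
proof -
  have "(\<lambda>m. exp (- of_real s) * ((of_real s * z) ^ m /\<^sub>R fact m)) sums (exp (- of_real s) * exp (of_real s * z))"
    by (intro sums_mult exp_converges)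
  moreover have "exp (- of_real s) * exp (of_real s * z) = exp (of_real s * (z - 1))"
    by (simp add: exp_add[symmetric] algebra_simps)
  moreover have "exp (- of_real s) * ((of_real s * z) ^ m /\<^sub>R fact m) = of_real (s ^ m / fact m * exp (- s)) * z ^ m" for m
    by (simp add: scaleR_conv_of_real power_mult_distrib exp_of_real[symmetric] divide_inverse)
  ultimately show ?thesis by simp
qed

lemma poisson_pmf_power_expectation:
  fixes \<theta> :: complex
  assumes "0 < s" "norm \<theta> = 1"
  shows "(\<integral>x. \<theta> ^ x \<partial>measure_pmf (poisson_pmf s)) = exp (of_real s * (\<theta> - 1))"
proof -
  have "(\<lambda>m. of_real (pmf (poisson_pmf s) m) * \<theta> ^ m) sums (\<integral>x. \<theta> ^ x \<partial>measure_pmf (poisson_pmf s))"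
    using measure_pmf.power_expectation_sums[of "\<lambda>x. x" "poisson_pmf s" \<theta>] assms by (simp add: pmf.rep_eq)
  then show ?thesis
    using sums_unique2[OF _ poisson_power_sums[of s \<theta>]] assms(1) by simp
qed

lemma (in prob_space) geometric_power_expectation:
  fixes \<theta> :: complex
  assumes X: "X \<in> M \<rightarrow>\<^sub>M count_space (UNIV :: nat set)" and \<theta>: "norm \<theta> = 1"
    and r: "0 \<le> r" "r < 1"
    and geo: "\<And>k. 1 \<le> k \<Longrightarrow> prob {x \<in> space M. X x = k} = (1 - r) * r ^ (k - 1)"
  shows "(\<integral>x. \<theta> ^ X x \<partial>M) = (1 - of_real r) * \<theta> / (1 - of_real r * \<theta>)"
proof -
  have series: "(\<lambda>m. of_real (prob {x \<in> space M. X x = Suc m}) * \<eta> ^ Suc m) sums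
      ((1 - of_real r) * \<eta> / (1 - of_real r * \<eta>))" if \<eta>: "norm \<eta> = 1" for \<eta> :: complex
  proof -
    have "(\<lambda>m. ((1 - of_real r) * \<eta>) * (of_real r * \<eta>) ^ m) sums
       (((1 - of_real r) * \<eta>) * (1 / (1 - of_real r * \<eta>)))"
      using r \<eta> by (intro sums_mult geometric_sums) (simp add: norm_mult)
    then show ?thesis by (simp add: geo power_mult_distrib mult_ac)
  qed
  \<comment> \<open>The case \<open>\<eta> = 1\<close> shows that the value \<open>0\<close>, not covered by \<open>geo\<close>, has probability \<open>0\<close>.\<close>
  have shift: "(\<integral>x. \<eta> ^ X x \<partial>M) = (1 - of_real r) * \<eta> / (1 - of_real r * \<eta>) + of_real (prob {x \<in> space M. X x = 0})"
    if "norm \<eta> = 1" for \<eta> :: complex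
    using sums_unique2[OF power_expectation_sums[OF X that] sums_Suc[OF series[OF that]]] by simp
  have "complex_of_real (prob {x \<in> space M. X x = 0}) = 0"
    using shift[of 1] r prob_space by simp
  then show ?thesis using shift[OF \<theta>] by simp
qed

text \<open>On \<open>W = m\<close> independence turns the power of \<open>\<theta>\<close> into the
  \<open>m\<close>-th power of the geometric generating function; summing over \<open>m\<close>
  evaluates the Poisson generating function there.\<close>

lemma compound_poisson_power_expectation:
  fixes \<theta> :: complex
  assumes fam: "poisson_geometric_family s r Q W \<zeta>" and s: "0 < s" and r: "0 \<le> r" "r < 1" and \<theta>: "norm \<theta> = 1"
  shows "(\<lambda>x. \<Sum>k=1..W x. \<zeta> k x) \<in> Q \<rightarrow>\<^sub>M count_space UNIV"
    and "(\<integral>x. \<theta> ^ (\<Sum>k=1..W x. \<zeta> k x) \<partial>Q) = exp (of_real s * ((1 - of_real r) * \<theta> / (1 - of_real r * \<theta>) - 1))"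
proof -
  have Q: "prob_space Q"
    and ind: "prob_space.indep_vars Q (\<lambda>_. count_space UNIV) (\<lambda>i. if i = 0 then W else \<zeta> i) UNIV"
    and dW: "distr Q (count_space UNIV) W = measure_pmf (poisson_pmf s)"
    and geo: "\<And>i k. 1 \<le> i \<Longrightarrow> 1 \<le> k \<Longrightarrow> measure Q {x \<in> space Q. \<zeta> i x = k} = (1 - r) * r ^ (k - 1)"
    using fam by (auto simp: poisson_geometric_family_def)
  interpret Q: prob_space Q by fact
  have rv: "(if i = 0 then W else \<zeta> i) \<in> Q \<rightarrow>\<^sub>M count_space UNIV" for i
    using ind by (simp add: Q.indep_vars_def)
  have W [measurable]: "W \<in> Q \<rightarrow>\<^sub>M count_space UNIV" using rv[of 0] by simp
  have \<zeta>: "\<zeta> i \<in> Q \<rightarrow>\<^sub>M count_space UNIV" if "1 \<le> i" for i using rv[of i] that by simp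
  have sum_meas: "(\<lambda>x. \<Sum>k=1..m. \<zeta> k x) \<in> Q \<rightarrow>\<^sub>M count_space UNIV" for m
  proof (induction m)
    case (Suc m)
    have [measurable]: "\<zeta> (Suc m) \<in> Q \<rightarrow>\<^sub>M count_space UNIV" "(\<lambda>x. \<Sum>k=1..m. \<zeta> k x) \<in> Q \<rightarrow>\<^sub>M count_space UNIV"
      using \<zeta> Suc by auto
    have "(\<lambda>x. (\<Sum>k=1..m. \<zeta> k x) + \<zeta> (Suc m) x) \<in> Q \<rightarrow>\<^sub>M count_space UNIV" by measurable
    then show ?case by simp
  qed simp
  show meas: "(\<lambda>x. \<Sum>k=1..W x. \<zeta> k x) \<in> Q \<rightarrow>\<^sub>M count_space UNIV"
    \<comment> \<open>The number of summands is random but takes countably many values, so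
      measurability for each fixed number suffices.\<close>
    using measurable_compose_countable[OF sum_meas W] .
  have probW: "Q.prob {x \<in> space Q. W x = m} = s ^ m / fact m * exp (- s)" for m
  proof -
    have "Q.prob {x \<in> space Q. W x = m} = measure (distr Q (count_space UNIV) W) {m}"
      by (subst measure_distr) (auto intro!: arg_cong[where f = Q.prob])
    then show ?thesis using s by (simp add: dW measure_pmf_single)
  qed
  define \<phi> where "\<phi> = (1 - of_real r) * \<theta> / (1 - of_real r * \<theta>)"
  \<comment> \<open>Factor 0 is the event \<open>W = m\<close>, the others are the powers for the
    single summands; this mirrors the indexing of the independent family, in which \<open>W\<close>
    occupies index 0.\<close>
  define Y where "Y m = (\<lambda>i x. if i = 0 then of_bool (W x = m) else \<theta> ^ \<zeta> i x)" for m :: nat and i :: nat and x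
  have term_eq: "(\<integral>x. of_bool (W x = m) * \<theta> ^ (\<Sum>k=1..W x. \<zeta> k x) \<partial>Q) = of_real (s ^ m / fact m * exp (- s)) * \<phi> ^ m" for m
  proof -
    have "of_bool (W x = m) * \<theta> ^ (\<Sum>k=1..W x. \<zeta> k x) = (\<Prod>i\<in>{0..m}. Y m i x)" for x
      by (auto simp: Y_def prod.atLeast_Suc_atMost power_sum)
    then have "(\<integral>x. of_bool (W x = m) * \<theta> ^ (\<Sum>k=1..W x. \<zeta> k x) \<partial>Q) = (\<integral>x. (\<Prod>i\<in>{0..m}. Y m i x) \<partial>Q)"
      by simp
    also have "\<dots> = (\<Prod>i\<in>{0..m}. \<integral>x. Y m i x \<partial>Q)"
    proof (rule Q.indep_vars_lebesgue_integral)
      have "Q.indep_vars (\<lambda>_. count_space UNIV) (\<lambda>i. if i = 0 then W else \<zeta> i) {0..m}"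
        using ind by (rule Q.indep_vars_subset) simp
      from Q.indep_vars_compose2[OF this, of "\<lambda>i v. if i = 0 then of_bool (v = m) else \<theta> ^ v" "\<lambda>_. borel"]
      have "Q.indep_vars (\<lambda>_. borel) (\<lambda>i x. if i = 0 then of_bool ((if i = 0 then W else \<zeta> i) x = m) else \<theta> ^ (if i = 0 then W else \<zeta> i) x) {0..m}"
        by simp
      also have "(\<lambda>i x. if i = 0 then of_bool ((if i = 0 then W else \<zeta> i) x = m) else \<theta> ^ (if i = 0 then W else \<zeta> i) x) = Y m"
        by (auto simp: Y_def fun_eq_iff)
      finally show "Q.indep_vars (\<lambda>_. borel) (Y m) {0..m}" .
      then have "Y m i \<in> borel_measurable Q" if "i \<in> {0..m}" for i
        using that by (simp add: Q.indep_vars_def)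
      then show "integrable Q (Y m i)" if "i \<in> {0..m}" for i
        using that by (intro Q.integrable_const_bound[where B = 1]) (auto simp: Y_def norm_power \<theta>)
    qed simp
    also have "\<dots> = (\<integral>x. Y m 0 x \<partial>Q) * (\<Prod>i\<in>{1..m}. \<integral>x. Y m i x \<partial>Q)"
      by (simp add: prod.atLeast_Suc_atMost)
    also have "(\<integral>x. Y m 0 x \<partial>Q) = of_real (s ^ m / fact m * exp (- s))"
      using Q.integral_of_bool_eq[OF W, of m] by (simp add: Y_def probW)
    also have "(\<Prod>i\<in>{1..m}. \<integral>x. Y m i x \<partial>Q) = (\<Prod>i\<in>{1..m}. \<phi>)"
      using Q.geometric_power_expectation[OF \<zeta> \<theta> r geo] by (intro prod.cong) (auto simp: Y_def \<phi>_def)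
    finally show ?thesis by simp
  qed
  have "(\<lambda>m. \<integral>x. of_bool (W x = m) * \<theta> ^ (\<Sum>k=1..W x. \<zeta> k x) \<partial>Q) sums (\<integral>x. \<theta> ^ (\<Sum>k=1..W x. \<zeta> k x) \<partial>Q)"
  proof (rule Q.expectation_partition_sums[OF W])
    show "(\<lambda>x. \<theta> ^ (\<Sum>k=1..W x. \<zeta> k x)) \<in> borel_measurable Q"
      by (rule measurable_compose[OF meas]) simp
  qed (simp add: norm_power \<theta>)
  then show "(\<integral>x. \<theta> ^ (\<Sum>k=1..W x. \<zeta> k x) \<partial>Q) = exp (of_real s * ((1 - of_real r) * \<theta> / (1 - of_real r * \<theta>) - 1))"
    unfolding term_eq \<phi>_def[symmetric] by (rule sums_unique2[OF _ poisson_power_sums])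
qed

text \<open>For integer values the characteristic function at \<open>u\<close> is the expected power
  of \<open>\<theta> = iexp u\<close>, so Levy continuity only asks about \<open>\<theta>\<close> on
  the unit circle.\<close>

lemma converges_in_distribution_nat:
  fixes X :: "nat \<Rightarrow> 'b \<Rightarrow> nat" and Y :: "'c \<Rightarrow> nat"
  assumes "prob_space M" "prob_space Q"
    and X: "\<And>n. (\<lambda>x. real (X n x)) \<in> borel_measurable M" and Y: "(\<lambda>x. real (Y x)) \<in> borel_measurable Q"
    and lim: "\<And>\<theta>::complex. norm \<theta> = 1 \<Longrightarrow> (\<lambda>n. \<integral>x. \<theta> ^ X n x \<partial>M) \<longlonglongrightarrow> (\<integral>x. \<theta> ^ Y x \<partial>Q)"
  shows "converges_in_distribution M (\<lambda>n x. real (X n x)) Q (\<lambda>x. real (Y x))"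
  unfolding converges_in_distribution_def
proof (rule levy_continuity)
  interpret M: prob_space M by fact
  interpret Q: prob_space Q by fact
  show "real_distribution (distr M borel (\<lambda>x. real (X n x)))" for n using X by simp
  show "real_distribution (distr Q borel (\<lambda>x. real (Y x)))" using Y by simp
  fix u
  have pow: "iexp (u * real m) = iexp u ^ m" for m
    by (simp add: exp_of_nat_mult[symmetric] mult_ac)
  have "char (distr M borel (\<lambda>x. real (X n x))) u = (\<integral>x. iexp (u * real (X n x)) \<partial>M)" for n
    unfolding char_def using X[of n] by (subst integral_distr) auto
  moreover have "char (distr Q borel (\<lambda>x. real (Y x))) u = (\<integral>x. iexp (u * real (Y x)) \<partial>Q)"
    unfolding char_def using Y by (subst integral_distr) auto
  ultimately show "(\<lambda>n. char (distr M borel (\<lambda>x. real (X n x))) u) \<longlonglongrightarrow> char (distr Q borel (\<lambda>x. real (Y x))) u"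
    using lim[of "iexp u"] unfolding pow by simp
qed

section \<open>Return times and periodic extensions\<close>

lemma shift_funpow: "(shift ^^ m) \<omega> = (\<lambda>i. \<omega> (i + m))"
  by (induction m arbitrary: \<omega>) (auto simp: shift_def)

lemma initial_word_cylinder: "\<omega> \<in> cylinder (initial_word \<alpha> n) \<longleftrightarrow> (\<forall>j<n. \<omega> j = \<alpha> j)"
  by (simp add: cylinder_def initial_word_def)

lemma length_initial_word [simp]: "length (initial_word \<alpha> n) = n"
  by (simp add: initial_word_def)

lemma take_initial_word: "r \<le> n \<Longrightarrow> take r (initial_word \<alpha> n) = initial_word \<alpha> r"
  by (simp add: initial_word_def take_map take_upt)

lemma cylinder_return_iff:
  assumes "1 \<le> k"
  shows "cylinder (initial_word \<alpha> n) \<inter> (shift ^^ k) -` cylinder (initial_word \<alpha> n) \<noteq> {} \<longleftrightarrow>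
    (\<forall>i. i + k < n \<longrightarrow> \<alpha> (i + k) = \<alpha> i)"
proof
  show "cylinder (initial_word \<alpha> n) \<inter> (shift ^^ k) -` cylinder (initial_word \<alpha> n) \<noteq> {} \<Longrightarrow>
    (\<forall>i. i + k < n \<longrightarrow> \<alpha> (i + k) = \<alpha> i)"
    by (auto simp: initial_word_cylinder shift_funpow) (metis add_lessD1)
next
  assume *: "\<forall>i. i + k < n \<longrightarrow> \<alpha> (i + k) = \<alpha> i"
  \<comment> \<open>The witness continues the word beyond \<open>n\<close> by copying the letter
    \<open>k\<close> places earlier in \<open>\<alpha>\<close>, so that the second copy of the word,
    started at \<open>k\<close>, is completed.\<close>
  have "(\<lambda>i. if i < n then \<alpha> i else \<alpha> (i - k)) \<in> cylinder (initial_word \<alpha> n) \<inter> (shift ^^ k) -` cylinder (initial_word \<alpha> n)"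
    using * by (auto simp: initial_word_cylinder shift_funpow)
  then show "cylinder (initial_word \<alpha> n) \<inter> (shift ^^ k) -` cylinder (initial_word \<alpha> n) \<noteq> {}" by blast
qed

lemma return_index_initial_word:
  "return_index (initial_word \<alpha> n) = Min {k\<in>{1..n}. \<forall>i. i + k < n \<longrightarrow> \<alpha> (i + k) = \<alpha> i}"
  unfolding return_index_def length_initial_word
  by (intro arg_cong[where f = Min] Collect_cong conj_cong refl cylinder_return_iff) simp

lemma return_index_props:
  fixes \<alpha> :: "nat \<Rightarrow> 'a"
  assumes "1 \<le> n"
  defines "r \<equiv> return_index (initial_word \<alpha> n)"
  shows "1 \<le> r" "r \<le> n" "\<And>i. i + r < n \<Longrightarrow> \<alpha> (i + r) = \<alpha> i"
    "\<And>s. 1 \<le> s \<Longrightarrow> s < r \<Longrightarrow> s < n \<Longrightarrow> \<exists>i. i + s < n \<and> \<alpha> (i + s) \<noteq> \<alpha> i"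
proof -
  let ?S = "{k\<in>{1..n}. \<forall>i. i + k < n \<longrightarrow> \<alpha> (i + k) = \<alpha> i}"
  have fin: "finite ?S" by simp
  have "n \<in> ?S" using assms(1) by auto
  then have "r \<in> ?S" unfolding r_def return_index_initial_word using fin by (intro Min_in) auto
  then show "1 \<le> r" "r \<le> n" "\<And>i. i + r < n \<Longrightarrow> \<alpha> (i + r) = \<alpha> i" by auto
  fix s assume s: "1 \<le> s" "s < r" "s < n"
  show "\<exists>i. i + s < n \<and> \<alpha> (i + s) \<noteq> \<alpha> i"
  proof (rule ccontr)
    assume "\<not> (\<exists>i. i + s < n \<and> \<alpha> (i + s) \<noteq> \<alpha> i)"
    then have "s \<in> ?S" using s by auto
    then have "r \<le> s" unfolding r_def return_index_initial_word by (rule Min_le[OF fin])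
    then show False using s(2) by simp
  qed
qed

text \<open>Each \<open>k\<close> below \<open>Z\<close> is refuted by one mismatch at a fixed
  place. There are finitely many of them, so all lie inside the word once \<open>n\<close> is
  large.\<close>

lemma eventually_return_index_ge:
  assumes "\<And>k. 1 \<le> k \<Longrightarrow> k < Z \<Longrightarrow> \<exists>i. \<alpha> (i + k) \<noteq> \<alpha> i"
  shows "\<forall>\<^sub>F n in sequentially. Z \<le> return_index (initial_word \<alpha> n)"
proof -
  from assms obtain f where f: "\<And>k. 1 \<le> k \<Longrightarrow> k < Z \<Longrightarrow> \<alpha> (f k + k) \<noteq> \<alpha> (f k)" by metis
  have "\<forall>\<^sub>F n in sequentially. \<forall>k\<in>{1..<Z}. f k + k < n"
    by (intro eventually_ball_finite ballI eventually_gt_at_top) simp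
  with eventually_ge_at_top[of 1] show ?thesis
  proof eventually_elim
    case (elim n)
    show ?case
    proof (rule ccontr)
      let ?r = "return_index (initial_word \<alpha> n)"
      assume "\<not> Z \<le> ?r"
      then have r: "1 \<le> ?r" "?r < Z" using return_index_props(1)[OF elim(1)] by auto
      then have "f ?r + ?r < n" using elim(2) by simp
      then have "\<alpha> (f ?r + ?r) = \<alpha> (f ?r)" by (rule return_index_props(3)[OF elim(1)])
      then show False using f[OF r] by simp
    qed
  qed
qed

text \<open>Writing an index by quotient and remainder modulo \<open>r\<close> separates the
  complete copies of the word from the final incomplete one, the case of quotient
  \<open>q\<close>.\<close>

lemma periodic_extension_initial_word:
  assumes "1 \<le> r"
  shows "periodic_extension (initial_word \<alpha> r) N = {\<omega>. \<forall>j<N. \<omega> j = \<alpha> (j mod r)}"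
proof -
  define q where "q = N div r"
  have N: "r * q + N mod r = N" by (simp add: q_def)
  have Nm: "N mod r < r" using assms by simp
  have 1: "\<omega> \<in> periodic_extension (initial_word \<alpha> r) N \<longleftrightarrow>
     (\<forall>k<q. \<forall>i<r. \<omega> (i + k * r) = \<alpha> i) \<and> (\<forall>i<N mod r. \<omega> (i + r * q) = \<alpha> i)" for \<omega>
    using N Nm unfolding periodic_extension_def Let_def length_initial_word q_def[symmetric]
    by (auto simp: take_initial_word initial_word_cylinder shift_funpow minus_mult_div_eq_mod q_def)
  have 2: "(\<forall>k<q. \<forall>i<r. \<omega> (i + k * r) = \<alpha> i) \<and> (\<forall>i<N mod r. \<omega> (i + r * q) = \<alpha> i) \<longleftrightarrow>
     (\<forall>j<N. \<omega> j = \<alpha> (j mod r))" for \<omega>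
  proof (intro iffI conjI allI impI)
    fix j assume h: "(\<forall>k<q. \<forall>i<r. \<omega> (i + k * r) = \<alpha> i) \<and> (\<forall>i<N mod r. \<omega> (i + r * q) = \<alpha> i)" and j: "j < N"
    have jj: "j = j mod r + j div r * r" by simp
    have "j div r \<le> q" using j by (simp add: q_def div_le_mono)
    then consider "j div r < q" | "j div r = q" by linarith
    then show "\<omega> j = \<alpha> (j mod r)"
    proof cases
      case 1
      then show ?thesis using h assms jj by (metis mod_less_divisor less_le_trans zero_less_one)
    next
      case 2
      then have "j mod r < N mod r" using j N jj by (metis add.commute add_less_cancel_left mult.commute)
      then show ?thesis using h jj 2 by (metis mult.commute)
    qed
  next
    fix k i assume h: "\<forall>j<N. \<omega> j = \<alpha> (j mod r)" and "k < q" "i < r"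
    have "i + k * r < (k + 1) * r" using \<open>i < r\<close> by simp
    also have "\<dots> \<le> q * r" using \<open>k < q\<close> by (intro mult_le_mono1) simp
    also have "\<dots> \<le> N" using N by (metis le_add1 mult.commute)
    finally have "\<omega> (i + k * r) = \<alpha> ((i + k * r) mod r)" using h by blast
    then show "\<omega> (i + k * r) = \<alpha> i" using \<open>i < r\<close> by simp
  next
    fix i assume h: "\<forall>j<N. \<omega> j = \<alpha> (j mod r)" and i: "i < N mod r"
    then have "i + r * q < N" using N by linarith
    then have "\<omega> (i + r * q) = \<alpha> ((i + r * q) mod r)" using h by blast
    then show "\<omega> (i + r * q) = \<alpha> i" using i Nm by simp
  qed
  show ?thesis unfolding set_eq_iff mem_Collect_eq 1 2 by simp
qed

lemma period_mod:
  fixes \<alpha> :: "nat \<Rightarrow> 'a"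
  assumes "1 \<le> r" "\<And>i. i + r < n \<Longrightarrow> \<alpha> (i + r) = \<alpha> i" "j < n"
  shows "\<alpha> (j mod r) = \<alpha> j"
  using assms(3)
proof (induction j rule: less_induct)
  case (less j)
  show ?case
  proof (cases "j < r")
    case False
    then have "\<alpha> ((j - r) mod r) = \<alpha> (j - r)" using less assms(1) by (intro less.IH) auto
    also have "\<dots> = \<alpha> j" using assms(2)[of "j - r"] False less.prems by simp
    finally show ?thesis using False by (simp add: le_mod_geq)
  qed simp
qed

section \<open>Block probabilities behind the given definitions, and the two limit laws\<close>

context multiple_hits
begin

lemma measure_cylinder: "measure M (cylinder (initial_word \<alpha> n)) = cyl_prob n"
proof -
  have "cylinder (initial_word \<alpha> n) = {\<omega>. \<forall>y\<in>{..<n}. \<omega> (id y) = \<alpha> y}"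
    by (auto simp: initial_word_cylinder)
  then show ?thesis using prob_pattern[of "{..<n}" id \<alpha>] by (simp add: cyl_prob_def)
qed

lemma hit_sum_eq: "hit_sum l d (initial_word \<alpha> n) N \<omega> = real (hits n {1..N} \<omega>)"
proof -
  have "hit l d (initial_word \<alpha> n) k \<omega> = of_bool (all_hit n k \<omega>)" for k
  proof (cases "all_hit n k \<omega>")
    case True
    then show ?thesis unfolding hit_def all_hit_def
      by (auto simp: shift_funpow initial_word_cylinder indicator_def add.commute intro!: prod.neutral)
  next
    case False
    then obtain i j where "i \<in> {1..l}" "j < n" "\<omega> (d i * k + j) \<noteq> \<alpha> j"
      unfolding all_hit_def by blast
    then have "i \<in> {1..l}" "(shift ^^ (d i * k)) \<omega> \<notin> cylinder (initial_word \<alpha> n)"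
      by (auto simp: shift_funpow initial_word_cylinder add.commute)
    then have "hit l d (initial_word \<alpha> n) k \<omega> = 0"
      unfolding hit_def by (intro prod_zero) (auto intro!: bexI[of _ i])
    then show ?thesis using False by simp
  qed
  then show ?thesis by (simp add: hit_sum_def hits_def)
qed

lemma hit_count_eq: "hit_count M l d t \<alpha> n = (\<lambda>\<omega>. real (hits n {1..obs_time t n} \<omega>))"
  unfolding hit_count_def hit_sum_eq observation_time_def measure_cylinder obs_time_def by simp

text \<open>Given the cylinder, the extension for \<open>d i\<close> prescribes
  \<open>d i * kappa l d r\<close> further letters, a whole number of periods. The value is
  therefore exact for every \<open>n\<close> and depends on \<open>n\<close> only through
  \<open>r\<close>.\<close>

lemma rho_eq:
  assumes n: "1 \<le> n"
  defines "r \<equiv> return_index (initial_word \<alpha> n)"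
  shows "rho M l d (initial_word \<alpha> n) = cyl_prob r ^ (\<Sum>i=1..l. d i * kappa l d r div r)"
proof -
  note r = return_index_props[OF n, where \<alpha> = \<alpha>, folded r_def]
  have mod: "\<alpha> (j mod r) = \<alpha> j" if "j < n" for j
    using period_mod[of r n \<alpha>, OF r(1) r(3) that] by simp
  have "cond_prob M (\<lambda>\<omega>. \<omega> \<in> periodic_extension (initial_word \<alpha> r) (n + d i * kappa l d r)) (\<lambda>\<omega>. \<omega> \<in> cylinder (initial_word \<alpha> n))
     = cyl_prob r ^ (d i * kappa l d r div r)" if i: "i \<in> {1..l}" for i
  proof -
    let ?N = "n + d i * kappa l d r"
    have "r dvd d i * kappa l d r"
      using kappa_dvd_iff[of r l d "kappa l d r"] r(1) i by simp
    then obtain e where e: "d i * kappa l d r = r * e" by (rule dvdE)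
    \<comment> \<open>The extension already lies in the cylinder, because the first \<open>n\<close>
      letters of \<open>\<alpha>\<close> repeat with period \<open>r\<close>; so the intersection is
      one prescribed pattern.\<close>
    have "{\<omega> \<in> space M. \<omega> \<in> periodic_extension (initial_word \<alpha> r) ?N \<and> \<omega> \<in> cylinder (initial_word \<alpha> n)} =
       {\<omega>. \<forall>y\<in>{..<?N}. \<omega> (id y) = \<alpha> (y mod r)}"
      using mod by (auto simp: space_UNIV periodic_extension_initial_word[OF r(1)] initial_word_cylinder)
    also have "prob \<dots> = (\<Prod>y<n + r * e. letter_prob (\<alpha> (y mod r)))"
      unfolding e[symmetric] by (rule prob_pattern) auto
    also have "\<dots> = (\<Prod>y<n. letter_prob (\<alpha> (y mod r))) * (\<Prod>y\<in>{n..<n + r * e}. letter_prob (\<alpha> (y mod r)))"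
      unfolding lessThan_atLeast0 by (rule prod.atLeastLessThan_concat[symmetric]) auto
    also have "(\<Prod>y<n. letter_prob (\<alpha> (y mod r))) = cyl_prob n"
      unfolding cyl_prob_def using mod by (intro prod.cong) auto
    also have "(\<Prod>y\<in>{n..<n + r * e}. letter_prob (\<alpha> (y mod r))) = (\<Prod>y<r. letter_prob (\<alpha> (y mod r))) ^ e"
      by (rule prod_periodic) simp
    also have "(\<Prod>y<r. letter_prob (\<alpha> (y mod r))) = cyl_prob r"
      unfolding cyl_prob_def by (intro prod.cong) auto
    finally have 1: "\<P>(\<omega> in M. \<omega> \<in> periodic_extension (initial_word \<alpha> r) ?N \<and> \<omega> \<in> cylinder (initial_word \<alpha> n)) = cyl_prob n * cyl_prob r ^ e" .
    have 2: "\<P>(\<omega> in M. \<omega> \<in> cylinder (initial_word \<alpha> n)) = cyl_prob n"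
      using measure_cylinder[of n] by (simp add: space_UNIV)
    show ?thesis
      unfolding cond_prob_def 1 2 using cyl_prob_pos[of n] r(1) e by simp
  qed
  then show ?thesis
    unfolding rho_def Let_def r_def[symmetric] length_initial_word take_initial_word[OF r(2)]
    by (simp add: power_sum)
qed

lemma hits_real_measurable: "finite I \<Longrightarrow> (\<lambda>\<omega>. real (hits n I \<omega>)) \<in> borel_measurable M"
  by (rule hits_measurable)

lemma aperiodic_case:
  assumes t: "t > 0" and aper: "\<And>s. 1 \<le> s \<Longrightarrow> \<exists>i. \<alpha> (i + s) \<noteq> \<alpha> i"
  shows "(\<lambda>n. enat (return_index (initial_word \<alpha> n))) \<longlonglongrightarrow> \<infinity>"
    and "(\<lambda>n. rho M l d (initial_word \<alpha> n)) \<longlonglongrightarrow> 0"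
    and "converges_in_distribution M (hit_count M l d t \<alpha>) (measure_pmf (poisson_pmf t)) real"
proof -
  let ?r = "\<lambda>n. return_index (initial_word \<alpha> n)"
  have r: "filterlim ?r at_top sequentially"
    unfolding filterlim_at_top using aper by (auto intro: eventually_return_index_ge)
  then show "(\<lambda>n. enat (?r n)) \<longlonglongrightarrow> \<infinity>"
    unfolding nhds_enat by (auto simp: filterlim_INF filterlim_principal filterlim_at_top)
  show "(\<lambda>n. rho M l d (initial_word \<alpha> n)) \<longlonglongrightarrow> 0"
  \<comment> \<open>The exponent in \<open>rho_eq\<close> is at least 1, so the parameter is at most
    the probability of the cylinder of length equal to the return index, which tends to
    infinity.\<close>
  proof (rule tendsto_sandwich[OF _ _ tendsto_const filterlim_compose[OF cyl_prob_tendsto r]])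
    show "\<forall>\<^sub>F n in sequentially. 0 \<le> rho M l d (initial_word \<alpha> n)"
      using eventually_ge_at_top[of 1] by eventually_elim (simp add: rho_eq less_imp_le[OF cyl_prob_pos])
    show "\<forall>\<^sub>F n in sequentially. rho M l d (initial_word \<alpha> n) \<le> cyl_prob (?r n)"
      using eventually_ge_at_top[of 1]
    proof eventually_elim
      case (elim n)
      have "0 < (\<Sum>i=1..l. d i * kappa l d (?r n) div ?r n)"
        using return_index_props(1)[OF elim, where \<alpha> = \<alpha>] by (intro kappa_exponent_pos) simp
      then have "cyl_prob (?r n) ^ (\<Sum>i=1..l. d i * kappa l d (?r n) div ?r n) \<le> cyl_prob (?r n) ^ 1"
        using cyl_prob_le_1 less_imp_le[OF cyl_prob_pos] by (intro power_decreasing) auto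
      then show ?case unfolding rho_eq[OF elim] by simp
    qed
  qed
  show "converges_in_distribution M (hit_count M l d t \<alpha>) (measure_pmf (poisson_pmf t)) real"
    unfolding hit_count_eq[abs_def]
  proof (rule converges_in_distribution_nat)
    fix \<theta> :: complex assume \<theta>: "norm \<theta> = 1"
    show "(\<lambda>n. \<integral>x. \<theta> ^ hits n {1..obs_time t n} x \<partial>M) \<longlonglongrightarrow> (\<integral>x. \<theta> ^ x \<partial>measure_pmf (poisson_pmf t))"
      unfolding poisson_pmf_power_expectation[OF t \<theta>]
    proof (rule aperiodic_limit[OF \<theta> t r])
      fix n s assume s: "1 \<le> s" "s < ?r n" "s < n"
      then show "\<exists>i. i + s < n \<and> \<alpha> (i + s) \<noteq> \<alpha> i"
        by (intro return_index_props(4)) auto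
    qed
  qed (auto simp: hits_real_measurable prob_space_axioms prob_space_measure_pmf)
qed

end

context periodic_multiple_hits
begin

lemma periodic_case:
  assumes t: "t > 0"
  shows "(\<lambda>n. enat (return_index (initial_word \<alpha> n))) \<longlonglongrightarrow> enat p"
    and "(\<lambda>n. rho M l d (initial_word \<alpha> n)) \<longlonglongrightarrow> \<rho>"
    and "\<rho> = measure M (cylinder (initial_word \<alpha> p)) powr (real \<kappa> / real p * (\<Sum>i=1..l. real (d i)))"
    and "poisson_geometric_family (t * (1 - \<rho>)) \<rho> Q W \<zeta> \<Longrightarrow>
      converges_in_distribution M (hit_count M l d t \<alpha>) Q (\<lambda>x. real (\<Sum>k=1..W x. \<zeta> k x))"
proof -
  have "\<forall>\<^sub>F n in sequentially. p \<le> return_index (initial_word \<alpha> n)"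
  proof (rule eventually_return_index_ge)
    fix k assume "1 \<le> k" "k < p"
    then show "\<exists>i. \<alpha> (i + k) \<noteq> \<alpha> i" using least[of k] by force
  qed
  with eventually_ge_at_top[of "p + 1"]
  have r: "\<forall>\<^sub>F n in sequentially. 1 \<le> n \<and> return_index (initial_word \<alpha> n) = p"
  proof eventually_elim
    case (elim n)
    \<comment> \<open>Once \<open>n > p\<close>, the period is itself an admissible return, so the
      minimum cannot exceed it.\<close>
    have "\<not> p < return_index (initial_word \<alpha> n)"
    proof
      assume "p < return_index (initial_word \<alpha> n)"
      with return_index_props(4)[where \<alpha> = \<alpha> and n = n and s = p] elim(1) p
      obtain i where "\<alpha> (i + p) \<noteq> \<alpha> i" by auto
      then show False using per by simp
    qed
    then show ?case using elim by simp
  qed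
  then show "(\<lambda>n. enat (return_index (initial_word \<alpha> n))) \<longlonglongrightarrow> enat p"
    by (intro tendsto_eventually) (auto elim: eventually_mono)
  from r show "(\<lambda>n. rho M l d (initial_word \<alpha> n)) \<longlonglongrightarrow> \<rho>"
    by (intro tendsto_eventually) (auto elim!: eventually_mono simp: rho_eq \<rho>_def \<kappa>_def)
  \<comment> \<open>Since \<open>p\<close> divides each \<open>d i * \<kappa>\<close>, integer
    division is exact and the natural exponent equals the real exponent \<open>k0\<close>.\<close>
  have "real (\<Sum>i=1..l. d i * \<kappa> div p) = (\<Sum>i=1..l. real (d i) * real \<kappa> / real p)"
    using p_dvd by (simp add: real_of_nat_div)
  also have "\<dots> = real \<kappa> / real p * (\<Sum>i=1..l. real (d i))"
    by (simp add: sum_distrib_left mult.commute)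
  finally show "\<rho> = measure M (cylinder (initial_word \<alpha> p)) powr (real \<kappa> / real p * (\<Sum>i=1..l. real (d i)))"
    unfolding measure_cylinder \<rho>_def using powr_realpow[OF cyl_prob_pos] by metis
  assume fam: "poisson_geometric_family (t * (1 - \<rho>)) \<rho> Q W \<zeta>"
  have pos: "0 < t * (1 - \<rho>)" using t rho_bounds by simp
  note compound = compound_poisson_power_expectation[OF fam pos less_imp_le[OF rho_bounds(1)] rho_bounds(2)]
  show "converges_in_distribution M (hit_count M l d t \<alpha>) Q (\<lambda>x. real (\<Sum>k=1..W x. \<zeta> k x))"
    unfolding hit_count_eq[abs_def]
  proof (rule converges_in_distribution_nat)
    show "prob_space Q" using fam by (simp add: poisson_geometric_family_def)
    show "(\<lambda>x. real (\<Sum>k=1..W x. \<zeta> k x)) \<in> borel_measurable Q"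
      by (rule measurable_compose[OF compound(1)[of 1]]) auto
    fix \<theta> :: complex assume \<theta>: "norm \<theta> = 1"
    show "(\<lambda>n. \<integral>x. \<theta> ^ hits n {1..obs_time t n} x \<partial>M) \<longlonglongrightarrow> (\<integral>x. \<theta> ^ (\<Sum>k=1..W x. \<zeta> k x) \<partial>Q)"
      unfolding compound(2)[OF \<theta>] by (rule periodic_limit[OF \<theta> t])
  qed (auto simp: hits_real_measurable prob_space_axioms)
qed

end

section \<open>Passage from the hypotheses to the locales, and conclusion\<close>

lemma iid_sequence_of_stationary:
  fixes M :: "(nat \<Rightarrow> 'a::countable) measure"
  assumes "stationary_probability M" "iid_coordinates M"
  shows "iid_sequence M"
proof -
  interpret prob_space M using assms(1) by (simp add: stationary_probability_def)
  have sp: "space M = UNIV"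
    using assms(1) sets_eq_imp_space_eq[of M seq_space]
    by (simp add: stationary_probability_def seq_space_def)
  have rv: "(\<lambda>\<omega>. \<omega> i) \<in> M \<rightarrow>\<^sub>M count_space UNIV" for i
    using assms(2) by (simp add: iid_coordinates_def indep_vars_def)
  show ?thesis
  proof
    show "space M = UNIV" by (rule sp)
    show "indep_vars (\<lambda>_. count_space UNIV) (\<lambda>i \<omega>. \<omega> i) UNIV"
      using assms(2) by (simp add: iid_coordinates_def)
    fix i a
    have eq: "prob {\<omega>. \<omega> j = a} = measure (distr M (count_space UNIV) (\<lambda>\<omega>. \<omega> j)) {a}" for j
      using rv[of j] by (simp add: measure_distr sp vimage_def)
    show "prob {\<omega>. \<omega> i = a} = prob {\<omega>. \<omega> 0 = a}"
      unfolding eq using assms(2) by (metis iid_coordinates_def)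
  qed
qed

text \<open>Every letter differs from \<open>a\<close> or from \<open>b\<close> and so misses the
  mass of that one. This argument avoids a maximum over the alphabet, which may be infinite.\<close>

lemma (in iid_sequence) letter_prob_uniform_bound:
  assumes "a \<noteq> (b :: 'a)" and pos: "\<And>x. 0 < letter_prob x"
  obtains c where "0 < c" "c < 1" "\<And>x. letter_prob x \<le> c"
proof
  have ev: "{\<omega>. \<omega> 0 = x} \<in> events" for x
    by (rule depends_only_event[of "{0}"]) (auto simp: depends_only_def)
  have pair: "letter_prob x + letter_prob y \<le> 1" if "x \<noteq> y" for x y
  proof -
    have "letter_prob x + letter_prob y = prob ({\<omega>. \<omega> 0 = x} \<union> {\<omega>. \<omega> 0 = y})"
      unfolding letter_prob_def using ev that by (intro finite_measure_Union[symmetric]) auto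
    then show ?thesis using prob_le_1 by simp
  qed
  show "letter_prob x \<le> max (1 - letter_prob a) (1 - letter_prob b)" for x
    using pair[of x a] pair[of x b] assms(1) by (cases "x = a") auto
  show "0 < max (1 - letter_prob a) (1 - letter_prob b)"
    using pair[OF assms(1)] pos[of a] pos[of b] by simp
  show "max (1 - letter_prob a) (1 - letter_prob b) < 1" using pos[of a] pos[of b] by simp
qed

theorem theorem2p9:
  fixes M :: "(nat \<Rightarrow> 'a :: countable) measure"
    and l :: nat and d :: "nat \<Rightarrow> nat" and t :: real
  assumes alphabet: "\<exists>a b :: 'a. a \<noteq> b"
    and stationary: "stationary_probability M"
    and product: "iid_coordinates M"
    and l: "l \<ge> 1"
    and d_pos: "d 1 \<ge> 1"
    and d_mono: "strict_mono_on {1..l} d"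
    and t: "t > 0"
  shows "\<forall>\<omega> :: nat \<Rightarrow> 'a. \<exists>(r\<omega> :: enat) (\<rho>\<omega> :: real).
     1 \<le> r\<omega> \<and>
     (\<lambda>n. enat (return_index (initial_word \<omega> n))) \<longlonglongrightarrow> r\<omega> \<and>
     (\<lambda>n. rho M l d (initial_word \<omega> n)) \<longlonglongrightarrow> \<rho>\<omega> \<and>
     (\<not> periodic_point \<omega> \<longrightarrow>
        converges_in_distribution M (hit_count M l d t \<omega>) (measure_pmf (poisson_pmf t)) real) \<and>
     (periodic_point \<omega> \<longrightarrow>
        (let p = minimal_period \<omega>;
             \<kappa>\<omega> = kappa l d p;
             k0 = real \<kappa>\<omega> / real p * (\<Sum>i=1..l. real (d i))
         in r\<omega> = enat p \<and>
            \<rho>\<omega> = measure M (cylinder (initial_word \<omega> p)) powr k0 \<and>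
            (\<forall>(Q :: 'b measure) (W :: 'b \<Rightarrow> nat) (\<zeta> :: nat \<Rightarrow> 'b \<Rightarrow> nat).
               poisson_geometric_family (t * (1 - \<rho>\<omega>)) \<rho>\<omega> Q W \<zeta> \<longrightarrow>
               converges_in_distribution M (hit_count M l d t \<omega>)
                 Q (\<lambda>x. real (\<Sum>k=1..W x. \<zeta> k x)))))"
proof
  fix \<omega> :: "nat \<Rightarrow> 'a"
  interpret iid_sequence M using stationary product by (rule iid_sequence_of_stationary)
  have pos: "0 < letter_prob a" for a
    using stationary by (simp add: stationary_probability_def letter_prob_def cylinder_def)
  obtain a b :: 'a where "a \<noteq> b" using alphabet by blast
  from letter_prob_uniform_bound[OF this pos]
  obtain c where c: "0 < c" "c < 1" "\<And>x. letter_prob x \<le> c" by blast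
  \<comment> \<open>The point \<open>\<omega>\<close> itself plays the role of
    \<open>\<alpha>\<close>; the random sequence is a separate variable throughout the
    locale.\<close>
  interpret multiple_hits M l d \<omega> c
    by unfold_locales (use l d_pos d_mono c pos in auto)
  have fix_iff: "(shift ^^ s) \<omega> = \<omega> \<longleftrightarrow> (\<forall>i. \<omega> (i + s) = \<omega> i)" for s
    by (simp add: shift_funpow fun_eq_iff)
  show "\<exists>(r\<omega> :: enat) (\<rho>\<omega> :: real).
     1 \<le> r\<omega> \<and>
     (\<lambda>n. enat (return_index (initial_word \<omega> n))) \<longlonglongrightarrow> r\<omega> \<and>
     (\<lambda>n. rho M l d (initial_word \<omega> n)) \<longlonglongrightarrow> \<rho>\<omega> \<and>
     (\<not> periodic_point \<omega> \<longrightarrow>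
        converges_in_distribution M (hit_count M l d t \<omega>) (measure_pmf (poisson_pmf t)) real) \<and>
     (periodic_point \<omega> \<longrightarrow>
        (let p = minimal_period \<omega>;
             \<kappa>\<omega> = kappa l d p;
             k0 = real \<kappa>\<omega> / real p * (\<Sum>i=1..l. real (d i))
         in r\<omega> = enat p \<and>
            \<rho>\<omega> = measure M (cylinder (initial_word \<omega> p)) powr k0 \<and>
            (\<forall>(Q :: 'b measure) (W :: 'b \<Rightarrow> nat) (\<zeta> :: nat \<Rightarrow> 'b \<Rightarrow> nat).
               poisson_geometric_family (t * (1 - \<rho>\<omega>)) \<rho>\<omega> Q W \<zeta> \<longrightarrow>
               converges_in_distribution M (hit_count M l d t \<omega>)
                 Q (\<lambda>x. real (\<Sum>k=1..W x. \<zeta> k x)))))"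
  proof (cases "periodic_point \<omega>")
    case False
    then have "\<exists>i. \<omega> (i + s) \<noteq> \<omega> i" if "1 \<le> s" for s
      using that unfolding periodic_point_def fix_iff by blast
    \<comment> \<open>At an aperiodic point the two limits are \<open>\<infinity>\<close> and
      0.\<close>
    from aperiodic_case[OF t this] False show ?thesis
      by (intro exI[of _ \<infinity>] exI[of _ 0]) auto
  next
    case True
    define p where "p = minimal_period \<omega>"
    have "1 \<le> p \<and> (shift ^^ p) \<omega> = \<omega>"
      using True unfolding p_def minimal_period_def periodic_point_def by (rule LeastI_ex)
    moreover have "p \<le> s" if "1 \<le> s" "\<And>i. \<omega> (i + s) = \<omega> i" for s
      unfolding p_def minimal_period_def using that by (intro Least_le) (simp add: fix_iff)
    ultimately interpret periodic_multiple_hits M l d \<omega> c p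
      by unfold_locales (auto simp: fix_iff)
    have "1 \<le> enat p" using p by (simp add: one_enat_def)
    with periodic_case[OF t] True show ?thesis
      unfolding Let_def p_def[symmetric]
      by (intro exI[of _ "enat p"] exI[of _ \<rho>]) (auto simp: \<kappa>_def)
  qed
qed

end
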